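(* Let $\natural:\mathcal H\to U(\mathfrak{sl}_2)$ be the algebra homomorphism determined by $A\mapsto \frac{H}{4}$, $B\mapsto \frac{E^2+F^2+\Lambda-1}{4}-\frac{H^2}{8}$, $C\mapsto \frac{E^2-F^2}{4}$. Then: (i) $\mathrm{Im}\,\natural=U(\mathfrak{sl}_2)_e$. (ii) $\mathrm{Ker}\,\natural$ is the two-sided ideal of $\mathcal H$ generated by $\beta$ and $16\,\Omega-24\,\alpha+3$.
   Context: All algebras are unital associative algebras over $\mathbb C$, algebra homomorphisms are unital, and $[x,y]=xy-yx$. $U(\mathfrak{sl}_2)$ is the algebra over $\mathbb C$ generated by $E,F,H$ subject to the relations $[H,E]=2E$, $[H,F]=-2F$, $[E,F]=H$. Its Casimir element is $\Lambda=EF+FE+\frac{H^2}{2}$, which is central. The algebra $U(\mathfrak{sl}_2)$ is $\mathbb Z$-graded by assigning degrees $1,-1,0$ to $E,F,H$ respectively; for $n\in\mathbb Z$ let $U_n$ denote the $n$-th homogeneous subspace, and define the subalgebra $U(\mathfrak{sl}_2)_e=\bigoplus_{n\in\mathbb Z}U_{2n}$. The universal Hahn algebra $\mathcal H$ is the algebra over $\mathbb C$ generated by $A,B,C$ with the relations asserting that $[A,B]=C$ and that each of $\alpha=[C,A]+2A^2+B$ and $\beta=[B,C]+4BA+2C$ is central in $\mathcal H$. Its Casimir element is $\Omega=4ABA+B^2-C^2-2\beta A+2(1-\alpha)B$ (central in $\mathcal H$). The map $\natural$ is a well-defined algebra homomorphism. *)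

theory Defs
  imports Complex_Main "HOL-Library.Poly_Mapping"
begin

section \<open>Complex algebras\<close>

class complex_algebra_1 = ring_1 +
  fixes scaleC :: "complex \<Rightarrow> 'a \<Rightarrow> 'a"  (infixr "*\<^sub>C" 75)
  assumes scaleC_add_right: "a *\<^sub>C (x + y) = a *\<^sub>C x + a *\<^sub>C y"
    and scaleC_add_left: "(a + b) *\<^sub>C x = a *\<^sub>C x + b *\<^sub>C x"
    and scaleC_scaleC [simp]: "a *\<^sub>C b *\<^sub>C x = (a * b) *\<^sub>C x"
    and scaleC_one [simp]: "1 *\<^sub>C x = x"
    and mult_scaleC_left [simp]: "(a *\<^sub>C x) * y = a *\<^sub>C (x * y)"
    and mult_scaleC_right [simp]: "x * (a *\<^sub>C y) = a *\<^sub>C (x * y)"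
begin

lemma scaleC_zero_left [simp]: "0 *\<^sub>C x = 0"
  using scaleC_add_left[of 0 0 x] by simp

lemma scaleC_zero_right [simp]: "a *\<^sub>C 0 = 0"
  using scaleC_add_right[of a 0 0] by simp

lemma scaleC_minus_left [simp]: "(- a) *\<^sub>C x = - (a *\<^sub>C x)"
  using scaleC_add_left[of a "- a" x] by (simp add: eq_neg_iff_add_eq_0 add.commute)

lemma scaleC_minus_right [simp]: "a *\<^sub>C (- x) = - (a *\<^sub>C x)"
  using scaleC_add_right[of a x "- x"] by (simp add: eq_neg_iff_add_eq_0 add.commute)

lemma scaleC_diff_right: "a *\<^sub>C (x - y) = a *\<^sub>C x - a *\<^sub>C y"
  using scaleC_add_right[of a x "- y"] by simp

lemma scaleC_sum_right: "a *\<^sub>C (\<Sum>i\<in>I. f i) = (\<Sum>i\<in>I. a *\<^sub>C f i)"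
  by (induction I rule: infinite_finite_induct) (simp_all add: scaleC_add_right)

lemma numeral_mult_scaleC: "numeral n * x = numeral n *\<^sub>C x"
proof -
  have "of_nat k * x = of_nat k *\<^sub>C x" for k
    by (induction k) (simp_all add: scaleC_add_left distrib_right)
  from this[of "numeral n"] show ?thesis by simp
qed

end

instantiation complex :: complex_algebra_1
begin
definition scaleC_complex_def [simp]: "scaleC_complex a (x::complex) = a * x"
instance by standard (simp_all add: algebra_simps)
end

definition algebra_hom :: "('a::complex_algebra_1 \<Rightarrow> 'b::complex_algebra_1) \<Rightarrow> bool" where
  "algebra_hom \<phi> \<longleftrightarrow>
     (\<forall>x y. \<phi> (x + y) = \<phi> x + \<phi> y) \<and> (\<forall>x y. \<phi> (x * y) = \<phi> x * \<phi> y) \<and>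
     \<phi> 1 = 1 \<and> (\<forall>a x. \<phi> (a *\<^sub>C x) = a *\<^sub>C \<phi> x)"

definition commutator :: "'a::ring \<Rightarrow> 'a \<Rightarrow> 'a" where
  "commutator x y = x * y - y * x"

definition two_sided_ideal :: "'a::ring_1 set \<Rightarrow> bool" where
  "two_sided_ideal I \<longleftrightarrow>
     0 \<in> I \<and> (\<forall>x\<in>I. \<forall>y\<in>I. x + y \<in> I) \<and> (\<forall>x\<in>I. \<forall>r. r * x \<in> I \<and> x * r \<in> I)"

definition ideal_generated :: "'a::ring_1 set \<Rightarrow> 'a set" where
  "ideal_generated S = \<Inter> {I. two_sided_ideal I \<and> S \<subseteq> I}"

lemma two_sided_ideal_ideal_generated: "two_sided_ideal (ideal_generated S)"
  unfolding ideal_generated_def two_sided_ideal_def by blast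

lemma ideal_generated_superset: "S \<subseteq> ideal_generated S"
  unfolding ideal_generated_def by blast

lemma ideal_generated_minimal: "two_sided_ideal I \<Longrightarrow> S \<subseteq> I \<Longrightarrow> ideal_generated S \<subseteq> I"
  unfolding ideal_generated_def by blast

lemma ideal_generated_zero: "0 \<in> ideal_generated S"
  and ideal_generated_add: "x \<in> ideal_generated S \<Longrightarrow> y \<in> ideal_generated S \<Longrightarrow> x + y \<in> ideal_generated S"
  and ideal_generated_mult_left: "x \<in> ideal_generated S \<Longrightarrow> r * x \<in> ideal_generated S"
  and ideal_generated_mult_right: "x \<in> ideal_generated S \<Longrightarrow> x * r \<in> ideal_generated S"
  using two_sided_ideal_ideal_generated[of S] unfolding two_sided_ideal_def by blast+

lemma ideal_generated_uminus: "x \<in> ideal_generated S \<Longrightarrow> - x \<in> ideal_generated S"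
  using ideal_generated_mult_left[of x S "- 1"] by simp

definition ideal_cong :: "'a::ring_1 set \<Rightarrow> 'a \<Rightarrow> 'a \<Rightarrow> bool" where
  "ideal_cong S x y \<longleftrightarrow> x - y \<in> ideal_generated S"

lemma equivp_ideal_cong: "equivp (ideal_cong S)"
proof (rule equivpI)
  show "reflp (ideal_cong S)"
    by (simp add: reflp_def ideal_cong_def ideal_generated_zero)
  show "symp (ideal_cong S)"
    unfolding symp_def ideal_cong_def using ideal_generated_uminus by (metis minus_diff_eq)
  show "transp (ideal_cong S)"
    unfolding transp_def ideal_cong_def using ideal_generated_add by (metis diff_add_cancel add_diff_eq)
qed

lemma ideal_cong_add:
  "ideal_cong S x x' \<Longrightarrow> ideal_cong S y y' \<Longrightarrow> ideal_cong S (x + y) (x' + y')"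
  unfolding ideal_cong_def using ideal_generated_add by (metis add_diff_add)

lemma ideal_cong_uminus: "ideal_cong S x x' \<Longrightarrow> ideal_cong S (- x) (- x')"
  unfolding ideal_cong_def using ideal_generated_uminus[of "x - x'" S] by simp

lemma ideal_cong_diff:
  "ideal_cong S x x' \<Longrightarrow> ideal_cong S y y' \<Longrightarrow> ideal_cong S (x - y) (x' - y')"
  using ideal_cong_add[of S x x' "- y" "- y'"] ideal_cong_uminus[of S y y'] by simp

lemma ideal_cong_mult:
  assumes "ideal_cong S x x'" "ideal_cong S y y'" shows "ideal_cong S (x * y) (x' * y')"
proof -
  have "(x - x') * y + x' * (y - y') \<in> ideal_generated S"
    using assms unfolding ideal_cong_def
    by (intro ideal_generated_add ideal_generated_mult_left ideal_generated_mult_right)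
  then show ?thesis by (simp add: ideal_cong_def algebra_simps)
qed

lemma ideal_congI: "x - y \<in> S \<Longrightarrow> ideal_cong S x y"
  unfolding ideal_cong_def using ideal_generated_superset by blast

section \<open>Free complex algebras\<close>

text \<open>The free algebra on the generators \<open>'g\<close> is the monoid algebra over the free monoid
  on \<open>'g\<close>; the free monoid is written additively so that the convolution product of
  \<open>poly_mapping\<close> applies.\<close>

datatype 'g free_word = Word (letters: "'g list")

instantiation free_word :: (type) monoid_add
begin
definition "0 = Word []"
definition "v + w = Word (letters v @ letters w)"
instance by standard (simp_all add: zero_free_word_def plus_free_word_def)
end

lemma letters_zero [simp]: "letters 0 = []"
  by (simp add: zero_free_word_def)

lemma letters_add [simp]: "letters (v + w) = letters v @ letters w"
  by (simp add: plus_free_word_def)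

type_synonym 'g free_algebra = "'g free_word \<Rightarrow>\<^sub>0 complex"

definition gen :: "'g \<Rightarrow> 'g free_algebra" where
  "gen g = Poly_Mapping.single (Word [g]) 1"

definition const :: "complex \<Rightarrow> 'g free_algebra" where
  "const a = Poly_Mapping.single 0 a"

lemma free_algebra_induct:
  fixes p :: "'g free_algebra"
  assumes "\<And>w a. P (Poly_Mapping.single w a)" "\<And>p q. P p \<Longrightarrow> P q \<Longrightarrow> P (p + q)"
  shows "P p"
proof (induction p rule: update_induct)
  case const
  show ?case using assms(1)[of 0 0] by simp
next
  case (update f a b)
  then have "Poly_Mapping.update a b f = f + Poly_Mapping.single a b"
    by (intro poly_mapping_eqI)
      (auto simp: lookup_update lookup_add lookup_single when_def not_in_keys_iff_lookup_eq_zero)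
  then show ?case using update assms by simp
qed

lemma const_add: "const (a + b) = const a + const b"
  by (simp add: const_def single_add)

lemma const_mult: "const (a * b) = const a * const b"
  by (simp add: const_def mult_single)

lemma const_one: "const 1 = 1"
  by (simp add: const_def)

lemma const_commute: "const a * p = p * const a"
proof (induction p rule: free_algebra_induct)
  case (1 w b)
  then show ?case by (simp add: const_def mult_single mult.commute)
qed (simp add: algebra_simps)

definition free_lift :: "('g \<Rightarrow> 'a::complex_algebra_1) \<Rightarrow> 'g free_algebra \<Rightarrow> 'a" where
  "free_lift f p =
     (\<Sum>w\<in>Poly_Mapping.keys p. Poly_Mapping.lookup p w *\<^sub>C prod_list (map f (letters w)))"

lemma free_lift_superset:
  assumes "finite K" "Poly_Mapping.keys p \<subseteq> K"
  shows "free_lift f p = (\<Sum>w\<in>K. Poly_Mapping.lookup p w *\<^sub>C prod_list (map f (letters w)))"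
  unfolding free_lift_def using assms
  by (intro sum.mono_neutral_left) (auto simp: in_keys_iff)

lemma free_lift_single: "free_lift f (Poly_Mapping.single w a) = a *\<^sub>C prod_list (map f (letters w))"
  by (subst free_lift_superset[of "{w}"]) auto

lemma free_lift_add: "free_lift f (p + q) = free_lift f p + free_lift f q"
proof -
  let ?K = "Poly_Mapping.keys p \<union> Poly_Mapping.keys q"
  have "Poly_Mapping.keys (p + q) \<subseteq> ?K" by (rule Poly_Mapping.keys_add)
  then show ?thesis
    by (simp add: free_lift_superset[of ?K] lookup_add scaleC_add_left sum.distrib)
qed

lemma free_lift_mult: "free_lift f (p * q) = free_lift f p * free_lift f q"
proof (induction p rule: free_algebra_induct)
  case (1 v a)
  then show ?case
  proof (induction q rule: free_algebra_induct)
    case (1 w b)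
    then show ?case by (simp add: mult_single free_lift_single mult.commute[of b a])
  qed (simp add: free_lift_add distrib_left)
qed (simp add: free_lift_add distrib_right)

lemma free_lift_const: "free_lift f (const a) = a *\<^sub>C 1"
  by (simp add: const_def free_lift_single)

lemma free_lift_one [simp]: "free_lift f 1 = 1"
  using free_lift_const[of f 1] by (simp add: const_one)

lemma free_lift_zero [simp]: "free_lift f 0 = 0"
  by (simp add: free_lift_def)

lemma free_lift_gen [simp]: "free_lift f (gen g) = f g"
  by (simp add: gen_def free_lift_single)

lemma free_lift_uminus: "free_lift f (- p) = - free_lift f p"
  using free_lift_add[of f p "- p"] by (simp add: eq_neg_iff_add_eq_0 add.commute)

lemma free_lift_diff: "free_lift f (p - q) = free_lift f p - free_lift f q"
  using free_lift_add[of f p "- q"] by (simp add: free_lift_uminus)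

lemma free_lift_numeral [simp]: "free_lift f (numeral n) = numeral n"
proof -
  have "free_lift f (of_nat k) = of_nat k" for k
    by (induction k) (simp_all add: free_lift_add)
  from this[of "numeral n"] show ?thesis by simp
qed

lemmas free_lift_simps = free_lift_add free_lift_diff free_lift_uminus free_lift_mult

lemma free_lift_cong_ideal:
  assumes "\<And>p. p \<in> S \<Longrightarrow> free_lift f p = 0" "ideal_cong S x y"
  shows "free_lift f x = free_lift f y"
proof -
  have "two_sided_ideal {p. free_lift f p = 0}"
    by (simp add: two_sided_ideal_def free_lift_simps)
  then have "ideal_generated S \<subseteq> {p. free_lift f p = 0}"
    by (rule ideal_generated_minimal) (use assms(1) in blast)
  then have "free_lift f (x - y) = 0"
    using assms(2) by (auto simp: ideal_cong_def)
  then show ?thesis by (simp add: free_lift_diff)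
qed

lemma free_algebra_generated:
  assumes "\<And>a. P (const a)" "\<And>g. P (gen g)"
    and "\<And>p q. P p \<Longrightarrow> P q \<Longrightarrow> P (p + q)" "\<And>p q. P p \<Longrightarrow> P q \<Longrightarrow> P (p * q)"
  shows "P p"
proof (induction p rule: free_algebra_induct)
  case (1 w a)
  have "P (Poly_Mapping.single (Word l) 1)" for l
  proof (induction l)
    case Nil
    then show ?case using assms(1)[of 1] by (simp add: const_def zero_free_word_def)
  next
    case (Cons g l)
    have "Poly_Mapping.single (Word (g # l)) 1 = gen g * Poly_Mapping.single (Word l) (1::complex)"
      by (simp add: gen_def mult_single plus_free_word_def)
    then show ?case using assms(2,4) Cons by simp
  qed
  from assms(4)[OF assms(1)[of a] this[of "letters w"]]
  show ?case by (simp add: const_def mult_single)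
qed (rule assms(3))

section \<open>The universal enveloping algebra of sl2\<close>

datatype sl2_gen = GE | GF | GH

definition sl2_relations :: "sl2_gen free_algebra set" where
  "sl2_relations =
     {commutator (gen GH) (gen GE) - 2 * gen GE,
      commutator (gen GH) (gen GF) - (- 2) * gen GF,
      commutator (gen GE) (gen GF) - gen GH}"

quotient_type usl2 = "sl2_gen free_algebra" / "ideal_cong sl2_relations"
  by (rule equivp_ideal_cong)

instantiation usl2 :: complex_algebra_1
begin
lift_definition zero_usl2 :: usl2 is 0 .
lift_definition one_usl2 :: usl2 is 1 .
lift_definition plus_usl2 :: "usl2 \<Rightarrow> usl2 \<Rightarrow> usl2" is "(+)" by (rule ideal_cong_add)
lift_definition minus_usl2 :: "usl2 \<Rightarrow> usl2 \<Rightarrow> usl2" is "(-)" by (rule ideal_cong_diff)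
lift_definition uminus_usl2 :: "usl2 \<Rightarrow> usl2" is uminus by (rule ideal_cong_uminus)
lift_definition times_usl2 :: "usl2 \<Rightarrow> usl2 \<Rightarrow> usl2" is "(*)" by (rule ideal_cong_mult)
lift_definition scaleC_usl2 :: "complex \<Rightarrow> usl2 \<Rightarrow> usl2" is "\<lambda>a p. const a * p"
  by (rule ideal_cong_mult[OF equivp_reflp[OF equivp_ideal_cong]])

instance
proof
  note refl = equivp_reflp[OF equivp_ideal_cong]
  fix x y z :: usl2 and a b :: complex
  show "x + y + z = x + (y + z)" by transfer (simp add: add.assoc refl)
  show "x + y = y + x" by transfer (simp add: add.commute refl)
  show "0 + x = x" by transfer (simp add: refl)
  show "- x + x = 0" by transfer (simp add: refl)
  show "x - y = x + - y" by transfer (simp add: refl)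
  show "x * y * z = x * (y * z)" by transfer (simp add: mult.assoc refl)
  show "1 * x = x" by transfer (simp add: refl)
  show "x * 1 = x" by transfer (simp add: refl)
  show "(x + y) * z = x * z + y * z" by transfer (simp add: distrib_right refl)
  show "x * (y + z) = x * y + x * z" by transfer (simp add: distrib_left refl)
  show "a *\<^sub>C (x + y) = a *\<^sub>C x + a *\<^sub>C y" by transfer (simp add: distrib_left refl)
  show "(a + b) *\<^sub>C x = a *\<^sub>C x + b *\<^sub>C x" by transfer (simp add: const_add distrib_right refl)
  show "a *\<^sub>C b *\<^sub>C x = (a * b) *\<^sub>C x" by transfer (simp add: const_mult mult.assoc refl)
  show "1 *\<^sub>C x = x" by transfer (simp add: const_one refl)
  show "(a *\<^sub>C x) * y = a *\<^sub>C (x * y)" by transfer (simp add: mult.assoc refl)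
  show "x * (a *\<^sub>C y) = a *\<^sub>C (x * y)"
    by transfer (metis const_commute mult.assoc refl)
  show "(0::usl2) \<noteq> 1"
  proof transfer
    have "free_lift (\<lambda>_. 0::complex) p = 0" if "p \<in> sl2_relations" for p
      using that by (auto simp: sl2_relations_def commutator_def free_lift_simps)
    then show "\<not> ideal_cong sl2_relations 0 1"
      using free_lift_cong_ideal[of sl2_relations "\<lambda>_. 0::complex" 0 1] by auto
  qed
qed
end

lift_definition sl2_E :: usl2 is "gen GE" .
lift_definition sl2_F :: usl2 is "gen GF" .
lift_definition sl2_H :: usl2 is "gen GH" .

lemma sl2_commutators:
  "commutator sl2_H sl2_E = 2 * sl2_E"
  "commutator sl2_H sl2_F = - 2 * sl2_F"
  "commutator sl2_E sl2_F = sl2_H"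
proof -
  have two: "(2::usl2) = abs_usl2 2"
    using one_usl2.abs_eq plus_usl2.abs_eq by (metis one_add_one one_usl2_def)
  show "commutator sl2_H sl2_E = 2 * sl2_E" "commutator sl2_H sl2_F = - 2 * sl2_F"
    "commutator sl2_E sl2_F = sl2_H"
    unfolding commutator_def two sl2_E_def sl2_F_def sl2_H_def
      times_usl2.abs_eq minus_usl2.abs_eq uminus_usl2.abs_eq usl2.abs_eq_iff
    by (rule ideal_congI; simp add: sl2_relations_def commutator_def)+
qed

definition sl2_casimir :: usl2 where
  "sl2_casimir = sl2_E * sl2_F + sl2_F * sl2_E + (1/2) *\<^sub>C sl2_H ^ 2"

primrec sl2_gen_degree :: "sl2_gen \<Rightarrow> int" where
  "sl2_gen_degree GE = 1"
| "sl2_gen_degree GF = - 1"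
| "sl2_gen_degree GH = 0"

definition sl2_word_degree :: "sl2_gen free_word \<Rightarrow> int" where
  "sl2_word_degree w = sum_list (map sl2_gen_degree (letters w))"

text \<open>\<open>usl2_homogeneous n\<close> is the span of the products of generators of total degree \<open>n\<close>,
  that is, the image of the degree \<open>n\<close> component of the free algebra.\<close>

definition usl2_homogeneous :: "int \<Rightarrow> usl2 set" where
  "usl2_homogeneous n =
     abs_usl2 ` {p. \<forall>w\<in>Poly_Mapping.keys p. sl2_word_degree w = n}"

text \<open>The sum of the subspaces \<open>usl2_homogeneous (2 * n)\<close> over all integers \<open>n\<close>: the elements
  are the finite sums of their members. It is direct because the defining relations are homogeneous.\<close>

definition usl2_even :: "usl2 set" where
  "usl2_even =
     {\<Sum>n\<in>N. u n | N u. finite N \<and> (\<forall>n\<in>N. u n \<in> usl2_homogeneous (2 * n))}"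

section \<open>The universal Hahn algebra\<close>

definition hahn_alpha_of :: "'a::ring_1 \<Rightarrow> 'a \<Rightarrow> 'a \<Rightarrow> 'a" where
  "hahn_alpha_of a b c = commutator c a + 2 * a ^ 2 + b"

definition hahn_beta_of :: "'a::ring_1 \<Rightarrow> 'a \<Rightarrow> 'a \<Rightarrow> 'a" where
  "hahn_beta_of a b c = commutator b c + 4 * b * a + 2 * c"

datatype hahn_gen = GA | GB | GC

definition hahn_relations :: "hahn_gen free_algebra set" where
  "hahn_relations =
     {commutator (gen GA) (gen GB) - gen GC} \<union>
     {commutator (hahn_alpha_of (gen GA) (gen GB) (gen GC)) x | x. True} \<union>
     {commutator (hahn_beta_of (gen GA) (gen GB) (gen GC)) x | x. True}"

quotient_type hahn = "hahn_gen free_algebra" / "ideal_cong hahn_relations"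
  by (rule equivp_ideal_cong)

instantiation hahn :: complex_algebra_1
begin
lift_definition zero_hahn :: hahn is 0 .
lift_definition one_hahn :: hahn is 1 .
lift_definition plus_hahn :: "hahn \<Rightarrow> hahn \<Rightarrow> hahn" is "(+)" by (rule ideal_cong_add)
lift_definition minus_hahn :: "hahn \<Rightarrow> hahn \<Rightarrow> hahn" is "(-)" by (rule ideal_cong_diff)
lift_definition uminus_hahn :: "hahn \<Rightarrow> hahn" is uminus by (rule ideal_cong_uminus)
lift_definition times_hahn :: "hahn \<Rightarrow> hahn \<Rightarrow> hahn" is "(*)" by (rule ideal_cong_mult)
lift_definition scaleC_hahn :: "complex \<Rightarrow> hahn \<Rightarrow> hahn" is "\<lambda>a p. const a * p"
  by (rule ideal_cong_mult[OF equivp_reflp[OF equivp_ideal_cong]])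

instance
proof
  note refl = equivp_reflp[OF equivp_ideal_cong]
  fix x y z :: hahn and a b :: complex
  show "x + y + z = x + (y + z)" by transfer (simp add: add.assoc refl)
  show "x + y = y + x" by transfer (simp add: add.commute refl)
  show "0 + x = x" by transfer (simp add: refl)
  show "- x + x = 0" by transfer (simp add: refl)
  show "x - y = x + - y" by transfer (simp add: refl)
  show "x * y * z = x * (y * z)" by transfer (simp add: mult.assoc refl)
  show "1 * x = x" by transfer (simp add: refl)
  show "x * 1 = x" by transfer (simp add: refl)
  show "(x + y) * z = x * z + y * z" by transfer (simp add: distrib_right refl)
  show "x * (y + z) = x * y + x * z" by transfer (simp add: distrib_left refl)
  show "a *\<^sub>C (x + y) = a *\<^sub>C x + a *\<^sub>C y" by transfer (simp add: distrib_left refl)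
  show "(a + b) *\<^sub>C x = a *\<^sub>C x + b *\<^sub>C x" by transfer (simp add: const_add distrib_right refl)
  show "a *\<^sub>C b *\<^sub>C x = (a * b) *\<^sub>C x" by transfer (simp add: const_mult mult.assoc refl)
  show "1 *\<^sub>C x = x" by transfer (simp add: const_one refl)
  show "(a *\<^sub>C x) * y = a *\<^sub>C (x * y)" by transfer (simp add: mult.assoc refl)
  show "x * (a *\<^sub>C y) = a *\<^sub>C (x * y)"
    by transfer (metis const_commute mult.assoc refl)
  show "(0::hahn) \<noteq> 1"
  proof transfer
    have "free_lift (\<lambda>_. 0::complex) p = 0" if "p \<in> hahn_relations" for p
      using that by (auto simp: hahn_relations_def commutator_def free_lift_simps)
    then show "\<not> ideal_cong hahn_relations 0 1"
      using free_lift_cong_ideal[of hahn_relations "\<lambda>_. 0::complex" 0 1] by auto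
  qed
qed
end

lift_definition hahn_A :: hahn is "gen GA" .
lift_definition hahn_B :: hahn is "gen GB" .
lift_definition hahn_C :: hahn is "gen GC" .

definition hahn_alpha :: hahn where "hahn_alpha = hahn_alpha_of hahn_A hahn_B hahn_C"

definition hahn_beta :: hahn where "hahn_beta = hahn_beta_of hahn_A hahn_B hahn_C"

definition hahn_casimir :: hahn where
  "hahn_casimir =
     4 * hahn_A * hahn_B * hahn_A + hahn_B ^ 2 - hahn_C ^ 2
     - 2 * hahn_beta * hahn_A + 2 * (1 - hahn_alpha) * hahn_B"

section \<open>Existence and uniqueness of the homomorphism to the enveloping algebra\<close>

context
  fixes e f h :: "'a::ring_1"
  assumes he: "h * e = e * h + 2 * e" and hf: "h * f = f * h - 2 * f" and fe: "f * e = e * f - h"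
begin

private lemma he': "h * (e * x) = e * (h * x) + 2 * (e * x)"
  by (metis he distrib_right mult.assoc)

private lemma hf': "h * (f * x) = f * (h * x) - 2 * (f * x)"
  by (metis hf left_diff_distrib mult.assoc)

private lemma fe': "f * (e * x) = e * (f * x) - h * x"
  by (metis fe left_diff_distrib mult.assoc)

private lemma numerals: "2 * x = x + x" "4 * x = x + x + x + x" "8 * x = x + x + x + x + x + x + x + x"
  "x * 2 = x + x" "x * 4 = x + x + x + x" "x * 8 = x + x + x + x + x + x + x + x" for x :: 'a
proof -
  have "(4::'a) = 1 + 1 + 1 + 1" "(8::'a) = 1 + 1 + 1 + 1 + 1 + 1 + 1 + 1" by simp_all
  then show "2 * x = x + x" "4 * x = x + x + x + x" "8 * x = x + x + x + x + x + x + x + x"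
    "x * 2 = x + x" "x * 4 = x + x + x + x" "x * 8 = x + x + x + x + x + x + x + x"
    by (simp_all only: distrib_left distrib_right mult_1_left mult_1_right mult_2 mult_2_right)
qed

private lemmas pbw = he hf fe he' hf' fe' numerals power2_eq_square commutator_def distrib_left
  distrib_right left_diff_distrib right_diff_distrib mult.assoc

lemma sl2_identity_commutator: "commutator h ((e + f) ^ 2 - 1) = 4 * (e ^ 2 - f ^ 2)"
  by (simp add: pbw)

lemma sl2_identity_beta:
  "commutator ((e + f) ^ 2 - 1) (e ^ 2 - f ^ 2) + 4 * ((e + f) ^ 2 - 1) * h + 8 * (e ^ 2 - f ^ 2) = 0"
  by (simp add: pbw)

lemma sl2_identity_alpha:
  "x \<in> {e, f, h} \<Longrightarrow>
   commutator (commutator (e ^ 2 - f ^ 2) h + 2 * h ^ 2 + 4 * ((e + f) ^ 2 - 1)) x = 0"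
  by (elim insertE; simp add: pbw)

end

lemma usl2_induct [case_names one E F H scale add mult]:
  assumes "P 1" "P sl2_E" "P sl2_F" "P sl2_H" "\<And>a x. P x \<Longrightarrow> P (a *\<^sub>C x)"
    and "\<And>x y. P x \<Longrightarrow> P y \<Longrightarrow> P (x + y)" "\<And>x y. P x \<Longrightarrow> P y \<Longrightarrow> P (x * y)"
  shows "P x"
proof (induction x rule: usl2.abs_induct)
  case (1 p)
  show ?case
  proof (induction p rule: free_algebra_generated)
    case (1 a)
    have "abs_usl2 (const a) = a *\<^sub>C 1"
      by (simp add: one_usl2_def scaleC_usl2.abs_eq)
    then show ?case using assms(1,5) by simp
  next
    case (2 g)
    show ?case using assms(2-4) by (cases g) (simp_all add: sl2_E_def sl2_F_def sl2_H_def)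
  next
    case (3 p q)
    then show ?case using assms(6) by (metis plus_usl2.abs_eq)
  next
    case (4 p q)
    then show ?case using assms(7) by (metis times_usl2.abs_eq)
  qed
qed

lemma hahn_induct [case_names one A B C scale add mult]:
  assumes "P 1" "P hahn_A" "P hahn_B" "P hahn_C" "\<And>a x. P x \<Longrightarrow> P (a *\<^sub>C x)"
    and "\<And>x y. P x \<Longrightarrow> P y \<Longrightarrow> P (x + y)" "\<And>x y. P x \<Longrightarrow> P y \<Longrightarrow> P (x * y)"
  shows "P x"
proof (induction x rule: hahn.abs_induct)
  case (1 p)
  show ?case
  proof (induction p rule: free_algebra_generated)
    case (1 a)
    have "abs_hahn (const a) = a *\<^sub>C 1"
      by (simp add: one_hahn_def scaleC_hahn.abs_eq)
    then show ?case using assms(1,5) by simp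
  next
    case (2 g)
    show ?case using assms(2-4) by (cases g) (simp_all add: hahn_A_def hahn_B_def hahn_C_def)
  next
    case (3 p q)
    then show ?case using assms(6) by (metis plus_hahn.abs_eq)
  next
    case (4 p q)
    then show ?case using assms(7) by (metis times_hahn.abs_eq)
  qed
qed

lemma usl2_central:
  assumes "commutator z sl2_E = 0" "commutator z sl2_F = 0" "commutator z sl2_H = 0"
  shows "commutator z x = 0"
proof (induction x rule: usl2_induct)
  case (mult x y)
  have "commutator z (x * y) = commutator z x * y + x * commutator z y"
    by (simp add: commutator_def algebra_simps)
  then show ?case using mult by simp
qed (use assms in \<open>simp_all add: commutator_def distrib_left distrib_right add_diff_add\<close>)

lemma ex1_hahn_hom:
  fixes a b c :: "'a::complex_algebra_1"
  assumes "commutator a b = c"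
    and "\<And>x. commutator (hahn_alpha_of a b c) x = 0" "\<And>x. commutator (hahn_beta_of a b c) x = 0"
  shows "\<exists>!\<phi>. algebra_hom \<phi> \<and> \<phi> hahn_A = a \<and> \<phi> hahn_B = b \<and> \<phi> hahn_C = c"
proof (rule ex_ex1I)
  define f where "f = case_hahn_gen a b c"
  define \<phi> where "\<phi> x = free_lift f (rep_hahn x)" for x
  have gens: "f GA = a" "f GB = b" "f GC = c" by (simp_all add: f_def)
  have alpha: "free_lift f (hahn_alpha_of (gen GA) (gen GB) (gen GC)) = hahn_alpha_of a b c"
    by (simp add: hahn_alpha_of_def commutator_def free_lift_simps power2_eq_square f_def)
  have beta: "free_lift f (hahn_beta_of (gen GA) (gen GB) (gen GC)) = hahn_beta_of a b c"
    by (simp add: hahn_beta_of_def commutator_def free_lift_simps f_def)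
  have comm: "free_lift f (commutator p q) = commutator (free_lift f p) (free_lift f q)" for p q
    by (simp add: commutator_def free_lift_simps)
  have "free_lift f p = 0" if "p \<in> hahn_relations" for p
    using that by (auto simp: hahn_relations_def comm alpha beta free_lift_diff gens assms)
  then have abs: "\<phi> (abs_hahn p) = free_lift f p" for p
    unfolding \<phi>_def
    by (rule free_lift_cong_ideal[OF _ Quotient_rep_abs[OF Quotient_hahn
          equivp_reflp[OF equivp_ideal_cong]]]) simp
  have add: "\<phi> (x + y) = \<phi> x + \<phi> y" for x y
    by (induction x rule: hahn.abs_induct, induction y rule: hahn.abs_induct)
      (simp add: plus_hahn.abs_eq abs free_lift_add)
  have mult: "\<phi> (x * y) = \<phi> x * \<phi> y" for x y
    by (induction x rule: hahn.abs_induct, induction y rule: hahn.abs_induct)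
      (simp add: times_hahn.abs_eq abs free_lift_mult)
  have scale: "\<phi> (r *\<^sub>C x) = r *\<^sub>C \<phi> x" for r x
    by (induction x rule: hahn.abs_induct)
      (simp add: scaleC_hahn.abs_eq abs free_lift_mult free_lift_const)
  have "\<phi> 1 = 1" by (simp add: one_hahn_def abs)
  with add mult scale
  show "\<exists>\<phi>. algebra_hom \<phi> \<and> \<phi> hahn_A = a \<and> \<phi> hahn_B = b \<and> \<phi> hahn_C = c"
    by (intro exI[of _ \<phi>])
      (simp add: algebra_hom_def hahn_A_def hahn_B_def hahn_C_def abs f_def)
next
  fix \<phi> \<psi> :: "hahn \<Rightarrow> 'a"
  assume *: "algebra_hom \<phi> \<and> \<phi> hahn_A = a \<and> \<phi> hahn_B = b \<and> \<phi> hahn_C = c"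
    "algebra_hom \<psi> \<and> \<psi> hahn_A = a \<and> \<psi> hahn_B = b \<and> \<psi> hahn_C = c"
  have "\<phi> x = \<psi> x" for x
    by (induction x rule: hahn_induct) (use * in \<open>simp_all add: algebra_hom_def\<close>)
  then show "\<phi> = \<psi>" by blast
qed

lemma ex1_natural:
  "\<exists>!\<phi> :: hahn \<Rightarrow> usl2. algebra_hom \<phi> \<and>
     \<phi> hahn_A = (1/4) *\<^sub>C sl2_H \<and>
     \<phi> hahn_B = (1/4) *\<^sub>C (sl2_E ^ 2 + sl2_F ^ 2 + sl2_casimir - 1) - (1/8) *\<^sub>C sl2_H ^ 2 \<and>
     \<phi> hahn_C = (1/4) *\<^sub>C (sl2_E ^ 2 - sl2_F ^ 2)"
proof -
  define b y where "b = (sl2_E + sl2_F) ^ 2 - 1" and "y = sl2_E ^ 2 - sl2_F ^ 2"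
  have "sl2_H * sl2_E = sl2_E * sl2_H + 2 * sl2_E" "sl2_H * sl2_F = sl2_F * sl2_H - 2 * sl2_F"
    "sl2_F * sl2_E = sl2_E * sl2_F - sl2_H"
    using sl2_commutators by (simp_all add: commutator_def algebra_simps)
  note ids = sl2_identity_commutator[OF this, folded b_def y_def]
    sl2_identity_alpha[OF this, folded b_def y_def]
    sl2_identity_beta[OF this, folded b_def y_def]
  have B: "(1/4) *\<^sub>C (sl2_E ^ 2 + sl2_F ^ 2 + sl2_casimir - 1) - (1/8) *\<^sub>C sl2_H ^ 2 = (1/4) *\<^sub>C b"
    by (simp add: b_def sl2_casimir_def power2_eq_square scaleC_add_right scaleC_diff_right
        distrib_left distrib_right)
  have comm: "commutator (r *\<^sub>C u) (s *\<^sub>C v) = (r * s) *\<^sub>C commutator u v" for r s and u v :: usl2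
    by (simp add: commutator_def scaleC_diff_right mult.commute)
  have alpha: "hahn_alpha_of ((1/4) *\<^sub>C sl2_H) ((1/4) *\<^sub>C b) ((1/4) *\<^sub>C y) =
      (1/16) *\<^sub>C (commutator y sl2_H + 2 * sl2_H ^ 2 + 4 * b)"
    by (simp add: hahn_alpha_of_def comm power2_eq_square scaleC_add_right
        numeral_mult_scaleC[where 'a = usl2])
  have beta: "hahn_beta_of ((1/4) *\<^sub>C sl2_H) ((1/4) *\<^sub>C b) ((1/4) *\<^sub>C y) =
      (1/16) *\<^sub>C (commutator b y + 4 * b * sl2_H + 8 * y)"
    by (simp add: hahn_beta_of_def comm scaleC_add_right numeral_mult_scaleC[where 'a = usl2])
  have *: "commutator (r *\<^sub>C u) v = r *\<^sub>C commutator u v" for r and u v :: usl2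
    using comm[of r u 1 v] by simp
  show ?thesis
    unfolding B y_def[symmetric]
  proof (rule ex1_hahn_hom)
    show "commutator ((1/4) *\<^sub>C sl2_H) ((1/4) *\<^sub>C b) = (1/4) *\<^sub>C y"
      by (simp add: comm ids(1) numeral_mult_scaleC[where 'a = usl2])
    show "commutator (hahn_alpha_of ((1/4) *\<^sub>C sl2_H) ((1/4) *\<^sub>C b) ((1/4) *\<^sub>C y)) x = 0" for x
      unfolding alpha * by (subst usl2_central) (simp_all add: ids(2))
    show "commutator (hahn_beta_of ((1/4) *\<^sub>C sl2_H) ((1/4) *\<^sub>C b) ((1/4) *\<^sub>C y)) x = 0" for x
      unfolding beta ids(3) by (simp add: commutator_def)
  qed
qed

end

theory Submission
  imports Defs
begin

text \<open>
  Write \<open>S = [A, C]\<close>. The change of generators \<open>D = B - S\<close>, \<open>R = S + C\<close>, \<open>L = S - C\<close> (the constants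
  \<open>hahn_sym\<close>, \<open>hahn_diag\<close>, \<open>hahn_raise\<close>, \<open>hahn_lower\<close>) explains the theorem: it yields
  \<open>[A, R] = R\<close> and \<open>[A, L] = -L\<close>, and the images of \<open>A\<close>, \<open>R\<close>, \<open>L\<close>, \<open>D\<close> are \<open>H/4\<close>, \<open>E\<^sup>2/2\<close>, \<open>F\<^sup>2/2\<close>,
  \<open>(EF + FE - 1)/4\<close>. Moreover \<open>\<alpha> = D + 2 A\<^sup>2\<close>, so \<open>D\<close> is a polynomial in \<open>A\<close> and the central
  element \<open>\<alpha>\<close>.

  The image: it lies in the even part because the images of the generators do, and it contains \<open>H\<close>,
  \<open>E\<^sup>2\<close>, \<open>F\<^sup>2\<close>, \<open>EF\<close>, \<open>FE\<close>. A subalgebra with these elements contains every word of even degree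
  (\<open>usl2_even_subset\<close>).

  The kernel: in terms of the new generators
  \<open>S\<^sup>2 - C\<^sup>2 = \<Omega> + 2 \<beta> A + D\<^sup>2 - 2 D\<close> and \<open>[S, C] = \<beta> - 4 D A\<close>. Hence modulo \<open>\<beta>\<close> and
  \<open>16 \<Omega> - 24 \<alpha> + 3\<close> both \<open>R L\<close> and \<open>L R\<close> are polynomials in \<open>\<alpha>\<close> and \<open>A\<close>, and the quotient of the Hahn
  algebra by these two elements is spanned by the products \<open>R\<^sup>n \<alpha>\<^sup>i A\<^sup>j\<close> and \<open>L\<^sup>n \<alpha>\<^sup>i A\<^sup>j\<close>
  (\<open>hahn_normal_span_UNIV\<close>). It remains to see that the images of these products are linearly
  independent. For that, \<open>U(sl\<^sub>2)\<close> acts by difference operators on functions of \<open>(z, t)\<close>, where \<open>\<alpha>\<close>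
  and \<open>A\<close> become multiplication by \<open>z\<close> and \<open>t\<close>, while \<open>R\<close> and \<open>L\<close> shift \<open>t\<close> by one in opposite
  directions (with a polynomial coefficient that is almost never zero). Products with different shifts
  cannot cancel, and for a fixed shift independence is that of the monomials \<open>z\<^sup>i t\<^sup>j\<close>.
\<close>

section \<open>Linear algebra and homomorphisms of complex algebras\<close>

global_interpretation calg: vector_space "scaleC :: complex \<Rightarrow> 'a \<Rightarrow> 'a::complex_algebra_1"
  by standard (simp_all add: scaleC_add_left scaleC_add_right)

text \<open>Linear combinations indexed by the family itself: \<open>span_explicit\<close> sums over a finite set of
  vectors, and a family that is not injective is handled by choosing one index per vector.\<close>

lemma (in vector_space) span_range_explicit:
  assumes "x \<in> span (range m)"
  obtains I r where "finite I" "x = (\<Sum>i\<in>I. scale (r i) (m i))"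
proof -
  obtain t r where t: "finite t" "t \<subseteq> range m" and x: "x = (\<Sum>v\<in>t. scale (r v) v)"
    using assms unfolding span_explicit by blast
  obtain I where I: "inj_on m I" "t = m ` I"
    using t(2) by (auto simp: subset_image_inj)
  show thesis
  proof (rule that)
    show "finite I"
      using I t(1) by (simp add: finite_image_iff)
    show "x = (\<Sum>i\<in>I. scale (r (m i)) (m i))"
      by (simp add: x I sum.reindex)
  qed
qed

lemma (in vector_space) span_closed_if_basis_closed:
  assumes "x \<in> span S" "Vector_Spaces.linear scale scale T" "\<And>b. b \<in> S \<Longrightarrow> T b \<in> span S"
  shows "T x \<in> span S"
proof -
  interpret T: Vector_Spaces.linear scale scale T by (fact assms(2))
  show ?thesis
    using assms(1)
  proof (induction rule: span_induct)
    case base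
    show ?case by (simp add: subspace_def T.add T.scale span_add span_scale span_zero)
  qed (fact assms(3))
qed

lemma linear_mult_left: "Vector_Spaces.linear scaleC scaleC ((*) (a::'a::complex_algebra_1))"
  by unfold_locales (simp_all add: distrib_left)

lemma of_int_mult_scaleC: "of_int k * x = of_int k *\<^sub>C (x :: 'a::complex_algebra_1)"
proof -
  have "of_nat n * x = of_nat n *\<^sub>C x" for n
    by (induction n) (simp_all add: scaleC_add_left distrib_right)
  then show ?thesis by (cases k rule: int_cases2) simp_all
qed

locale algebra_homomorphism =
  fixes \<phi> :: "'a::complex_algebra_1 \<Rightarrow> 'b::complex_algebra_1"
  assumes hom: "algebra_hom \<phi>"
begin

lemma add: "\<phi> (x + y) = \<phi> x + \<phi> y"
  and mult: "\<phi> (x * y) = \<phi> x * \<phi> y"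
  and one: "\<phi> 1 = 1"
  and scale: "\<phi> (a *\<^sub>C x) = a *\<^sub>C \<phi> x"
  using hom by (simp_all add: algebra_hom_def)

lemma zero: "\<phi> 0 = 0"
  using scale[of 0 0] by simp

lemma minus: "\<phi> (- x) = - \<phi> x"
  using add[of x "- x"] by (simp add: zero eq_neg_iff_add_eq_0 add.commute)

lemma diff: "\<phi> (x - y) = \<phi> x - \<phi> y"
  using add[of x "- y"] by (simp add: minus)

lemma power: "\<phi> (x ^ n) = \<phi> x ^ n"
  by (induction n) (simp_all add: one mult)

lemma numeral: "\<phi> (numeral n) = numeral n"
  using scale[of "numeral n" 1] by (simp add: one numeral_mult_scaleC[symmetric])

lemma sum: "\<phi> (\<Sum>i\<in>I. f i) = (\<Sum>i\<in>I. \<phi> (f i))"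
  by (induction I rule: infinite_finite_induct) (simp_all add: zero add)

lemma commutator: "\<phi> (commutator x y) = commutator (\<phi> x) (\<phi> y)"
  by (simp add: commutator_def diff mult)

lemmas simps = add mult one scale zero minus diff power numeral sum commutator

lemma two_sided_ideal_kernel: "two_sided_ideal {x. \<phi> x = 0}"
  by (simp add: two_sided_ideal_def simps)

end

lemma commutator_scaleC:
  "commutator (r *\<^sub>C x) (s *\<^sub>C y) = (r * s) *\<^sub>C commutator x (y :: 'a::complex_algebra_1)"
  by (simp add: commutator_def scaleC_diff_right mult.commute)

lemma scaleC_power2: "(a *\<^sub>C x) ^ 2 = (a * a) *\<^sub>C (x :: 'a::complex_algebra_1) ^ 2"
  by (simp add: power2_eq_square)

lemma subspace_two_sided_ideal:
  assumes "two_sided_ideal (I :: 'a::complex_algebra_1 set)" shows "calg.subspace I"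
  unfolding calg.subspace_def
proof (intro conjI ballI allI)
  fix a x assume "x \<in> I"
  then have "(a *\<^sub>C 1) * x \<in> I" using assms unfolding two_sided_ideal_def by blast
  then show "a *\<^sub>C x \<in> I" by simp
qed (use assms in \<open>auto simp: two_sided_ideal_def\<close>)

section \<open>Raising and lowering elements of the Hahn algebra\<close>

lemma hahn_commutator_A_B: "commutator hahn_A hahn_B = hahn_C"
  unfolding commutator_def hahn_A_def hahn_B_def hahn_C_def times_hahn.abs_eq minus_hahn.abs_eq
    hahn.abs_eq_iff
  by (rule ideal_congI) (simp add: hahn_relations_def commutator_def)

lemma hahn_alpha_central: "hahn_alpha * x = x * hahn_alpha"
proof (induction x rule: hahn.abs_induct)
  case (1 p)
  have two: "(2::hahn) = abs_hahn 2"
    using one_hahn.abs_eq plus_hahn.abs_eq by (metis one_add_one one_hahn_def)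
  have alpha: "hahn_alpha = abs_hahn (hahn_alpha_of (gen GA) (gen GB) (gen GC))"
    by (simp add: hahn_alpha_def hahn_alpha_of_def power2_eq_square commutator_def two
        hahn_A_def hahn_B_def hahn_C_def times_hahn.abs_eq minus_hahn.abs_eq plus_hahn.abs_eq)
  show ?case
    unfolding alpha times_hahn.abs_eq hahn.abs_eq_iff
    by (rule ideal_congI) (auto simp: hahn_relations_def commutator_def)
qed

text \<open>Under \<open>\<natural>\<close> the element \<open>[A, C]\<close> goes to \<open>(E\<^sup>2 + F\<^sup>2)/4\<close>, the symmetric counterpart of the
  image \<open>(E\<^sup>2 - F\<^sup>2)/4\<close> of \<open>C\<close>. What remains of \<open>B\<close> has degree \<open>0\<close>, and the sum and difference of the
  two are the multiples \<open>E\<^sup>2/2\<close> and \<open>F\<^sup>2/2\<close> of the raising and lowering operators.\<close>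

definition hahn_sym :: hahn where "hahn_sym = commutator hahn_A hahn_C"
definition hahn_diag :: hahn where "hahn_diag = hahn_B - hahn_sym"
definition hahn_raise :: hahn where "hahn_raise = hahn_sym + hahn_C"
definition hahn_lower :: hahn where "hahn_lower = hahn_sym - hahn_C"

lemma hahn_alpha_eq: "hahn_alpha = hahn_diag + 2 * hahn_A ^ 2"
  by (simp add: hahn_alpha_def hahn_alpha_of_def hahn_diag_def hahn_sym_def commutator_def)

text \<open>With small coefficients written as repeated sums, an identity between normally ordered
  polynomials in noncommuting elements reduces to the cancellation of equal summands.\<close>

lemma ring_numerals: "2 * x = x + x" "4 * x = x + x + x + x" "3 * x = x + x + x"
  "x * 2 = x + x" "x * 4 = x + x + x + x" "x * 3 = x + x + x" for x :: "'a::ring_1"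
proof -
  have "(4::'a) = 1 + 1 + 1 + 1" "(3::'a) = 1 + 1 + 1" by simp_all
  then show "2 * x = x + x" "4 * x = x + x + x + x" "3 * x = x + x + x"
    "x * 2 = x + x" "x * 4 = x + x + x + x" "x * 3 = x + x + x"
    by (simp_all only: distrib_left distrib_right mult_1_left mult_1_right mult_2 mult_2_right)
qed

lemmas ring_expand = ring_numerals power2_eq_square commutator_def distrib_left
  distrib_right left_diff_distrib right_diff_distrib mult.assoc

text \<open>The rules for normal ordering. \<open>[A, D] = 0\<close> holds because \<open>\<alpha> = D + 2 A\<^sup>2\<close> is central, and then
  \<open>[A, S] = [A, B] = C\<close>. For the last two rules, \<open>[D, x] = -2 [A\<^sup>2, x]\<close>, again by centrality of \<open>\<alpha>\<close>.\<close>

lemma hahn_straightening: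
  shows "hahn_A * hahn_sym = hahn_sym * hahn_A + hahn_C"
    and "hahn_A * hahn_C = hahn_C * hahn_A + hahn_sym"
    and "hahn_A * hahn_diag = hahn_diag * hahn_A"
    and "hahn_diag * hahn_C = hahn_C * hahn_diag - 4 * hahn_sym * hahn_A - 2 * hahn_C"
    and "hahn_diag * hahn_sym = hahn_sym * hahn_diag - 4 * hahn_C * hahn_A - 2 * hahn_sym"
proof -
  have diag: "hahn_diag = hahn_alpha - 2 * hahn_A ^ 2"
    by (simp add: hahn_alpha_eq)
  show AC: "hahn_A * hahn_C = hahn_C * hahn_A + hahn_sym"
    by (simp add: hahn_sym_def commutator_def)
  show Ad: "hahn_A * hahn_diag = hahn_diag * hahn_A"
    using hahn_alpha_central[of hahn_A] by (simp add: diag ring_expand)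
  show As: "hahn_A * hahn_sym = hahn_sym * hahn_A + hahn_C"
    using hahn_commutator_A_B Ad by (simp add: hahn_diag_def ring_expand algebra_simps)
  have AC': "hahn_A * (hahn_C * x) = hahn_C * (hahn_A * x) + hahn_sym * x"
    and As': "hahn_A * (hahn_sym * x) = hahn_sym * (hahn_A * x) + hahn_C * x" for x
    by (metis AC As distrib_right mult.assoc)+
  show "hahn_diag * hahn_C = hahn_C * hahn_diag - 4 * hahn_sym * hahn_A - 2 * hahn_C"
    using hahn_alpha_central[of hahn_C] by (simp add: diag ring_expand AC AC' As As')
  show "hahn_diag * hahn_sym = hahn_sym * hahn_diag - 4 * hahn_C * hahn_A - 2 * hahn_sym"
    using hahn_alpha_central[of hahn_sym] by (simp add: diag ring_expand AC AC' As As')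
qed

lemma hahn_A_raise: "hahn_A * hahn_raise = hahn_raise * (hahn_A + 1)"
  and hahn_A_lower: "hahn_A * hahn_lower = hahn_lower * (hahn_A - 1)"
  by (simp_all add: hahn_raise_def hahn_lower_def hahn_straightening algebra_simps)

lemma hahn_straightening_nested:
  "hahn_A * (hahn_sym * x) = hahn_sym * (hahn_A * x) + hahn_C * x"
  "hahn_A * (hahn_C * x) = hahn_C * (hahn_A * x) + hahn_sym * x"
  "hahn_A * (hahn_diag * x) = hahn_diag * (hahn_A * x)"
  by (metis hahn_straightening(1-3) distrib_right mult.assoc)+

text \<open>The next two identities are where \<open>\<beta>\<close> and \<open>\<Omega>\<close> enter: they express \<open>[S, C]\<close> and
  \<open>S\<^sup>2 - C\<^sup>2\<close>, and these two determine \<open>R L\<close> and \<open>L R\<close>.\<close>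

lemma hahn_beta_eq: "hahn_beta = commutator hahn_sym hahn_C + 4 * hahn_diag * hahn_A"
proof -
  have B: "hahn_B = hahn_sym + hahn_diag" by (simp add: hahn_diag_def)
  show ?thesis
    unfolding hahn_beta_def hahn_beta_of_def B
    by (simp add: ring_expand hahn_straightening)
qed

lemma hahn_casimir_eq:
  "hahn_casimir = hahn_sym ^ 2 - hahn_C ^ 2 - 2 * hahn_beta * hahn_A + 2 * hahn_diag - hahn_diag ^ 2"
proof -
  have B: "hahn_B = hahn_sym + hahn_diag" by (simp add: hahn_diag_def)
  have "hahn_alpha * hahn_B = (hahn_sym + hahn_diag) * (hahn_diag + 2 * hahn_A ^ 2)"
    using hahn_alpha_central[of hahn_B] by (simp add: B hahn_alpha_eq)
  then have "2 * (1 - hahn_alpha) * hahn_B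
    = 2 * hahn_B - 2 * ((hahn_sym + hahn_diag) * (hahn_diag + 2 * hahn_A ^ 2))"
    by (simp add: mult.assoc left_diff_distrib right_diff_distrib)
  then show ?thesis
    unfolding hahn_casimir_def
    by (simp add: B ring_expand hahn_straightening hahn_straightening_nested)
qed

section \<open>Spanning modulo the kernel relations\<close>

definition hahn_kernel_relator :: hahn where
  "hahn_kernel_relator = 16 * hahn_casimir - 24 * hahn_alpha + 3"

definition hahn_kernel_ideal :: "hahn set" where
  "hahn_kernel_ideal = ideal_generated {hahn_beta, hahn_kernel_relator}"

text \<open>One family for both directions of the grading: the image in \<open>U(sl\<^sub>2)\<close> has degree \<open>2 k\<close>.\<close>

definition hahn_weight :: "int \<Rightarrow> hahn" where
  "hahn_weight k = (if 0 \<le> k then hahn_raise ^ nat k else hahn_lower ^ nat (- k))"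

definition hahn_monomial :: "int \<times> nat \<times> nat \<Rightarrow> hahn" where
  "hahn_monomial = (\<lambda>(k, i, j). hahn_weight k * hahn_alpha ^ i * hahn_A ^ j)"

abbreviation hahn_normal_span :: "hahn set" where
  "hahn_normal_span \<equiv> calg.span (hahn_kernel_ideal \<union> range hahn_monomial)"

lemma two_sided_ideal_hahn_kernel_ideal: "two_sided_ideal hahn_kernel_ideal"
  unfolding hahn_kernel_ideal_def by (rule two_sided_ideal_ideal_generated)

text \<open>\<open>(S + C) (S - C)\<close> and \<open>(S - C) (S + C)\<close> equal \<open>S\<^sup>2 - C\<^sup>2\<close> minus and plus \<open>[S, C]\<close>, and
  modulo the ideal \<open>\<Omega>\<close> may be replaced by \<open>(24 \<alpha> - 3)/16\<close> and \<open>\<beta>\<close> by \<open>0\<close>.\<close>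

lemma hahn_products_mod_kernel_ideal:
  defines "q \<equiv> (3 / 2) *\<^sub>C hahn_alpha - (3 / 16) *\<^sub>C 1 + hahn_diag ^ 2 - 2 * hahn_diag"
  shows "hahn_raise * hahn_lower - (q + 4 * hahn_diag * hahn_A) \<in> hahn_kernel_ideal"
    and "hahn_lower * hahn_raise - (q - 4 * hahn_diag * hahn_A) \<in> hahn_kernel_ideal"
proof -
  let ?I = hahn_kernel_ideal
  note sub = subspace_two_sided_ideal[OF two_sided_ideal_hahn_kernel_ideal]
  have beta: "hahn_beta \<in> ?I" and rel: "hahn_kernel_relator \<in> ?I"
    unfolding hahn_kernel_ideal_def using ideal_generated_superset by blast+
  have betaA: "hahn_beta * hahn_A \<in> ?I"
    using beta unfolding hahn_kernel_ideal_def by (rule ideal_generated_mult_right)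
  let ?r = "(1 / 16) *\<^sub>C hahn_kernel_relator + 2 *\<^sub>C (hahn_beta * hahn_A)"
  have r: "?r \<in> ?I"
    using rel betaA by (intro calg.subspace_add[OF sub] calg.subspace_scale[OF sub])
  have three: "(3::hahn) = 3 *\<^sub>C 1"
    using numeral_mult_scaleC[of "num.Bit1 num.One" "1::hahn"] by simp
  have casimir: "hahn_casimir = (1 / 16) *\<^sub>C hahn_kernel_relator + (3 / 2) *\<^sub>C hahn_alpha - (3 / 16) *\<^sub>C 1"
    by (simp add: hahn_kernel_relator_def three scaleC_add_right scaleC_diff_right
        numeral_mult_scaleC[where 'a = hahn])
  have "hahn_sym ^ 2 - hahn_C ^ 2
      = hahn_casimir + 2 *\<^sub>C (hahn_beta * hahn_A) - 2 * hahn_diag + hahn_diag ^ 2"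
    by (simp add: hahn_casimir_eq numeral_mult_scaleC[where 'a = hahn])
  then have squares: "hahn_sym ^ 2 - hahn_C ^ 2 = ?r + q"
    by (simp add: q_def casimir algebra_simps)
  have comm: "commutator hahn_sym hahn_C = hahn_beta - 4 * hahn_diag * hahn_A"
    by (simp add: hahn_beta_eq)
  have "hahn_raise * hahn_lower - (q + 4 * hahn_diag * hahn_A) = ?r - hahn_beta"
    using squares comm
    by (simp add: hahn_raise_def hahn_lower_def commutator_def power2_eq_square algebra_simps)
  then show "hahn_raise * hahn_lower - (q + 4 * hahn_diag * hahn_A) \<in> ?I"
    using calg.subspace_diff[OF sub r beta] by simp
  have "hahn_lower * hahn_raise - (q - 4 * hahn_diag * hahn_A) = ?r + hahn_beta"
    using squares comm
    by (simp add: hahn_raise_def hahn_lower_def commutator_def power2_eq_square algebra_simps)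
  then show "hahn_lower * hahn_raise - (q - 4 * hahn_diag * hahn_A) \<in> ?I"
    using calg.subspace_add[OF sub r beta] by simp
qed

lemma hahn_A_weight: "hahn_A * hahn_weight k = hahn_weight k * (hahn_A + of_int k)"
proof -
  have raise: "hahn_A * hahn_raise ^ n = hahn_raise ^ n * (hahn_A + of_nat n)" for n
  proof (induction n)
    case (Suc n)
    have "hahn_A * hahn_raise ^ Suc n = hahn_raise * (hahn_A * hahn_raise ^ n + hahn_raise ^ n)"
      by (simp add: mult.assoc[symmetric] hahn_A_raise) (simp add: algebra_simps)
    then show ?case by (simp add: Suc algebra_simps)
  qed simp
  have lower: "hahn_A * hahn_lower ^ n = hahn_lower ^ n * (hahn_A - of_nat n)" for n
  proof (induction n)
    case (Suc n)
    have "hahn_A * hahn_lower ^ Suc n = hahn_lower * (hahn_A * hahn_lower ^ n - hahn_lower ^ n)"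
      by (simp add: mult.assoc[symmetric] hahn_A_lower) (simp add: algebra_simps)
    then show ?case by (simp add: Suc algebra_simps)
  qed simp
  show ?thesis
    using raise[of "nat k"] lower[of "nat (- k)"] by (simp add: hahn_weight_def)
qed

text \<open>Left multiplication by \<open>A\<close> moves past the weight factor at the cost of a scalar. Multiplication
  by \<open>R\<close> lengthens a power of \<open>R\<close>; in front of a power of \<open>L\<close> the product \<open>R L\<close> appears, which acts
  modulo the ideal as a polynomial in \<open>\<alpha>\<close> and \<open>A\<close>, for which closure is already known. Powers of \<open>A\<close>
  stand to the right of the weight factor so that no binomial expansion is needed.\<close>

lemma hahn_normal_span_mult_left:
  assumes "x \<in> hahn_normal_span"
  shows "hahn_A * x \<in> hahn_normal_span"
    and "hahn_alpha * x \<in> hahn_normal_span"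
    and "hahn_raise * x \<in> hahn_normal_span"
    and "hahn_lower * x \<in> hahn_normal_span"
proof -
  let ?K = hahn_normal_span
  have ideal: "y \<in> ?K" if "y \<in> hahn_kernel_ideal" for y
    using that by (intro calg.span_base) blast
  have ideal_mult: "r * y \<in> ?K" if "y \<in> hahn_kernel_ideal" for r y
    using that two_sided_ideal_hahn_kernel_ideal ideal unfolding two_sided_ideal_def by blast
  have monomial: "hahn_weight k * hahn_alpha ^ i * hahn_A ^ j \<in> ?K" for k i j
    by (intro calg.span_base UnI2 image_eqI[of _ _ "(k, i, j)"]) (simp_all add: hahn_monomial_def)
  have closed: "r * y \<in> ?K"
    if "\<And>k i j. r * (hahn_weight k * hahn_alpha ^ i * hahn_A ^ j) \<in> ?K" "y \<in> ?K" for r y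
    using that(2) linear_mult_left
  proof (rule calg.span_closed_if_basis_closed)
    fix b assume "b \<in> hahn_kernel_ideal \<union> range hahn_monomial"
    then show "r * b \<in> ?K"
      using ideal_mult that(1) by (auto simp: hahn_monomial_def)
  qed
  have A: "hahn_A * y \<in> ?K" if "y \<in> ?K" for y
  proof (rule closed)
    fix k i j
    have alpha_power: "hahn_A * hahn_alpha ^ n = hahn_alpha ^ n * hahn_A" for n
      using power_commuting_commutes[of hahn_alpha hahn_A n] hahn_alpha_central by metis
    have "hahn_A * (hahn_weight k * hahn_alpha ^ i * hahn_A ^ j)
        = hahn_weight k * (hahn_A * hahn_alpha ^ i + of_int k * hahn_alpha ^ i) * hahn_A ^ j"
      by (simp add: mult.assoc[symmetric] hahn_A_weight) (simp add: mult.assoc distrib_left distrib_right)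
    also have "\<dots> = hahn_weight k * hahn_alpha ^ i * hahn_A ^ Suc j
        + of_int k *\<^sub>C (hahn_weight k * hahn_alpha ^ i * hahn_A ^ j)"
      by (simp add: alpha_power of_int_mult_scaleC)
        (simp add: mult.assoc distrib_left distrib_right)
    finally show "hahn_A * (hahn_weight k * hahn_alpha ^ i * hahn_A ^ j) \<in> ?K"
      by (metis calg.span_add calg.span_scale monomial)
  qed (fact that)
  have alpha: "hahn_alpha * y \<in> ?K" if "y \<in> ?K" for y
  proof (rule closed)
    fix k i j
    have "hahn_alpha * (hahn_weight k * hahn_alpha ^ i * hahn_A ^ j)
        = hahn_weight k * hahn_alpha ^ Suc i * hahn_A ^ j"
      by (metis hahn_alpha_central mult.assoc power_Suc)
    then show "hahn_alpha * (hahn_weight k * hahn_alpha ^ i * hahn_A ^ j) \<in> ?K"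
      by (metis monomial)
  qed (fact that)
  have diag: "hahn_diag * y \<in> ?K" if "y \<in> ?K" for y
  proof -
    have "hahn_diag * y = hahn_alpha * y - 2 *\<^sub>C (hahn_A * (hahn_A * y))"
      by (simp add: hahn_alpha_eq distrib_right power2_eq_square mult.assoc
          numeral_mult_scaleC[where 'a = hahn])
    then show ?thesis
      using A alpha that by (simp add: calg.span_diff calg.span_scale)
  qed
  define q where "q = (3 / 2) *\<^sub>C hahn_alpha - (3 / 16) *\<^sub>C 1 + hahn_diag ^ 2 - 2 * hahn_diag"
  note products = hahn_products_mod_kernel_ideal[folded q_def]
  have q: "q * y + c *\<^sub>C (hahn_diag * (hahn_A * y)) \<in> ?K" if "y \<in> ?K" for y c
  proof -
    have "q * y = (3 / 2) *\<^sub>C (hahn_alpha * y) - (3 / 16) *\<^sub>C y + hahn_diag * (hahn_diag * y)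
        - 2 *\<^sub>C (hahn_diag * y)"
      by (simp add: q_def distrib_right left_diff_distrib power2_eq_square mult.assoc
          numeral_mult_scaleC[where 'a = hahn])
    then show ?thesis
      using A alpha diag that by (simp add: calg.span_diff calg.span_add calg.span_scale)
  qed
  have raise_lower: "hahn_raise * (hahn_lower * y) \<in> ?K" if "y \<in> ?K" for y
  proof -
    have "hahn_raise * (hahn_lower * y)
        = (hahn_raise * hahn_lower - (q + 4 * hahn_diag * hahn_A)) * y
          + (q * y + 4 *\<^sub>C (hahn_diag * (hahn_A * y)))"
      by (simp add: distrib_right left_diff_distrib mult.assoc numeral_mult_scaleC[where 'a = hahn])
    moreover have "(hahn_raise * hahn_lower - (q + 4 * hahn_diag * hahn_A)) * y \<in> ?K"
      using products(1) two_sided_ideal_hahn_kernel_ideal ideal unfolding two_sided_ideal_def by blast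
    ultimately show ?thesis using q[OF that] by (metis calg.span_add)
  qed
  have lower_raise: "hahn_lower * (hahn_raise * y) \<in> ?K" if "y \<in> ?K" for y
  proof -
    have "hahn_lower * (hahn_raise * y)
        = (hahn_lower * hahn_raise - (q - 4 * hahn_diag * hahn_A)) * y
          + (q * y + (- 4) *\<^sub>C (hahn_diag * (hahn_A * y)))"
      by (simp add: distrib_right left_diff_distrib mult.assoc numeral_mult_scaleC[where 'a = hahn])
    moreover have "(hahn_lower * hahn_raise - (q - 4 * hahn_diag * hahn_A)) * y \<in> ?K"
      using products(2) two_sided_ideal_hahn_kernel_ideal ideal unfolding two_sided_ideal_def by blast
    ultimately show ?thesis using q[OF that] by (metis calg.span_add)
  qed
  have raise: "hahn_raise * y \<in> ?K" if "y \<in> ?K" for y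
  proof (rule closed)
    fix k i j
    show "hahn_raise * (hahn_weight k * hahn_alpha ^ i * hahn_A ^ j) \<in> ?K"
    proof (cases "0 \<le> k")
      case True
      then have "hahn_raise * hahn_weight k = hahn_weight (k + 1)"
        by (simp add: hahn_weight_def nat_add_distrib)
      then show ?thesis by (metis monomial mult.assoc)
    next
      case False
      then have "nat (- k) = Suc (nat (- (k + 1)))" by simp
      then have "hahn_weight k = hahn_lower * hahn_weight (k + 1)"
        using False by (auto simp: hahn_weight_def)
      then show ?thesis using raise_lower[OF monomial] by (simp add: mult.assoc)
    qed
  qed (fact that)
  have lower: "hahn_lower * y \<in> ?K" if "y \<in> ?K" for y
  proof (rule closed)
    fix k i j
    show "hahn_lower * (hahn_weight k * hahn_alpha ^ i * hahn_A ^ j) \<in> ?K"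
    proof (cases "k \<le> 0")
      case True
      then have "nat (- (k - 1)) = Suc (nat (- k))" by simp
      then have "hahn_lower * hahn_weight k = hahn_weight (k - 1)"
        using True by (cases "k = 0") (simp_all add: hahn_weight_def)
      then show ?thesis by (metis monomial mult.assoc)
    next
      case False
      then have "nat k = Suc (nat (k - 1))" by simp
      then have "hahn_weight k = hahn_raise * hahn_weight (k - 1)"
        using False by (simp add: hahn_weight_def)
      then show ?thesis using lower_raise[OF monomial] by (simp add: mult.assoc)
    qed
  qed (fact that)
  show "hahn_A * x \<in> ?K" "hahn_alpha * x \<in> ?K" "hahn_raise * x \<in> ?K" "hahn_lower * x \<in> ?K"
    using A alpha raise lower assms by blast+
qed

lemma hahn_C_eq: "hahn_C = (1 / 2) *\<^sub>C (hahn_raise - hahn_lower)"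
  and hahn_B_eq: "hahn_B = (1 / 2) *\<^sub>C (hahn_raise + hahn_lower) + (hahn_alpha - 2 *\<^sub>C hahn_A ^ 2)"
proof -
  have half: "(1 / 2) *\<^sub>C (y + y) = y" for y :: hahn
    using scaleC_add_left[of "1/2" "1/2" y] by (simp add: scaleC_add_right)
  show "hahn_C = (1 / 2) *\<^sub>C (hahn_raise - hahn_lower)"
    by (simp add: hahn_raise_def hahn_lower_def half)
  have "hahn_raise + hahn_lower = hahn_sym + hahn_sym"
    by (simp add: hahn_raise_def hahn_lower_def)
  then show "hahn_B = (1 / 2) *\<^sub>C (hahn_raise + hahn_lower) + (hahn_alpha - 2 *\<^sub>C hahn_A ^ 2)"
    by (simp add: half hahn_alpha_eq numeral_mult_scaleC[where 'a = hahn])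
      (simp add: hahn_diag_def)
qed

text \<open>The normal span contains \<open>1\<close> and is closed under left multiplication by \<open>A\<close>, \<open>\<alpha>\<close>, \<open>R\<close> and
  \<open>L\<close>, which generate the algebra.\<close>

lemma hahn_normal_span_UNIV: "x \<in> hahn_normal_span"
proof -
  let ?K = hahn_normal_span
  note mult = hahn_normal_span_mult_left
  note span = calg.span_add calg.span_diff calg.span_scale
  have "\<forall>y\<in>?K. x * y \<in> ?K"
  proof (induction x rule: hahn_induct)
    case B
    show ?case
      by (auto simp: hahn_B_eq distrib_right left_diff_distrib power2_eq_square mult.assoc intro!: mult span)
  next
    case C
    show ?case
      by (auto simp: hahn_C_eq left_diff_distrib intro!: mult span)
  qed (auto simp: distrib_right mult.assoc intro: mult span)
  moreover have "1 \<in> ?K"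
    by (intro calg.span_base UnI2 image_eqI[of _ _ "(0, 0, 0)"])
      (simp_all add: hahn_monomial_def hahn_weight_def)
  ultimately show ?thesis by (metis mult_1_right)
qed

section \<open>The even subalgebra\<close>

definition sl2_gen_value :: "sl2_gen \<Rightarrow> usl2" where
  "sl2_gen_value = case_sl2_gen sl2_E sl2_F sl2_H"

lemma supported_free_algebra_induct:
  fixes p :: "'g free_algebra"
  assumes "\<forall>w\<in>Poly_Mapping.keys p. Q w" "P 0"
    and "\<And>w a. Q w \<Longrightarrow> P (Poly_Mapping.single w a)" "\<And>p q. P p \<Longrightarrow> P q \<Longrightarrow> P (p + q)"
  shows "P p"
  using assms(1)
proof (induction p rule: update_induct)
  case const
  show ?case by (fact assms(2))
next
  case (update p w a)
  have "Poly_Mapping.update w a p = p + Poly_Mapping.single w a"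
    using update.hyps by (intro poly_mapping_eqI)
      (auto simp: lookup_update lookup_add lookup_single when_def not_in_keys_iff_lookup_eq_zero)
  moreover have "Poly_Mapping.keys (Poly_Mapping.update w a p) = insert w (Poly_Mapping.keys p)"
    using update.hyps by (simp add: keys_update)
  ultimately show ?case
    using update assms(3,4) by simp
qed

lemma abs_usl2_single:
  "abs_usl2 (Poly_Mapping.single w a) = a *\<^sub>C prod_list (map sl2_gen_value (letters w))"
proof -
  have "abs_usl2 (Poly_Mapping.single (Word l) 1) = prod_list (map sl2_gen_value l)" for l
  proof (induction l)
    case Nil
    then show ?case by (simp add: one_usl2_def zero_free_word_def[symmetric])
  next
    case (Cons g l)
    have "Poly_Mapping.single (Word (g # l)) 1 = gen g * Poly_Mapping.single (Word l) (1::complex)"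
      by (simp add: gen_def mult_single plus_free_word_def)
    moreover have "abs_usl2 (gen g) = sl2_gen_value g"
      by (cases g) (simp_all add: sl2_gen_value_def sl2_E_def sl2_F_def sl2_H_def)
    ultimately show ?case using Cons by (simp add: times_usl2.abs_eq[symmetric])
  qed
  from this[of "letters w"] have "a *\<^sub>C abs_usl2 (Poly_Mapping.single w 1)
      = a *\<^sub>C prod_list (map sl2_gen_value (letters w))" by simp
  then show ?thesis by (simp add: scaleC_usl2.abs_eq const_def mult_single)
qed

lemma usl2_homogeneous_zero: "0 \<in> usl2_homogeneous n"
  unfolding usl2_homogeneous_def by (rule image_eqI[of _ _ 0]) (simp_all add: zero_usl2_def)

lemma usl2_homogeneous_add:
  assumes "x \<in> usl2_homogeneous n" "y \<in> usl2_homogeneous n"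
  shows "x + y \<in> usl2_homogeneous n"
proof -
  obtain p q where "x = abs_usl2 p" "y = abs_usl2 q"
    and deg: "\<forall>w\<in>Poly_Mapping.keys p. sl2_word_degree w = n" "\<forall>w\<in>Poly_Mapping.keys q. sl2_word_degree w = n"
    using assms unfolding usl2_homogeneous_def by blast
  moreover have "\<forall>w\<in>Poly_Mapping.keys (p + q). sl2_word_degree w = n"
    using deg Poly_Mapping.keys_add[of p q] by blast
  ultimately show ?thesis
    unfolding usl2_homogeneous_def by (simp add: plus_usl2.abs_eq)
qed

lemma usl2_even_add:
  assumes "x \<in> usl2_even" "y \<in> usl2_even"
  shows "x + y \<in> usl2_even"
proof -
  obtain M u where M: "finite M" "\<forall>n\<in>M. u n \<in> usl2_homogeneous (2 * n)" "x = sum u M"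
    using assms(1) unfolding usl2_even_def by blast
  obtain N v where N: "finite N" "\<forall>n\<in>N. v n \<in> usl2_homogeneous (2 * n)" "y = sum v N"
    using assms(2) unfolding usl2_even_def by blast
  define u' v' where "u' n = (if n \<in> M then u n else 0)" and "v' n = (if n \<in> N then v n else 0)" for n
  have "sum u M = sum u' (M \<union> N)" "sum v N = sum v' (M \<union> N)"
    using M(1) N(1) by (auto intro!: sum.mono_neutral_cong_left simp: u'_def v'_def)
  then have "x + y = (\<Sum>n\<in>M \<union> N. u' n + v' n)"
    by (simp add: M N sum.distrib)
  moreover have "u' n + v' n \<in> usl2_homogeneous (2 * n)" for n
    using M(2) N(2) by (auto simp: u'_def v'_def intro!: usl2_homogeneous_add usl2_homogeneous_zero)
  ultimately show ?thesis
    using M(1) N(1) unfolding usl2_even_def by blast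
qed

lemma usl2_even_zero: "0 \<in> usl2_even"
  by (auto simp: usl2_even_def intro!: exI[of _ "{}"])

lemma usl2_even_homogeneous:
  assumes "x \<in> usl2_homogeneous n" "even n" shows "x \<in> usl2_even"
proof -
  have "x = (\<Sum>k\<in>{n div 2}. x)" by simp
  moreover have "\<forall>k\<in>{n div 2}. x \<in> usl2_homogeneous (2 * k)" using assms by simp
  ultimately show ?thesis unfolding usl2_even_def by blast
qed

text \<open>Elements of the even part are represented by free polynomials all of whose words have even
  degree. In this form closure under products is immediate.\<close>

lemma usl2_even_iff:
  "x \<in> usl2_even \<longleftrightarrow> (\<exists>p. x = abs_usl2 p \<and> (\<forall>w\<in>Poly_Mapping.keys p. even (sl2_word_degree w)))"
proof
  assume "x \<in> usl2_even"
  then obtain N u where "finite N" "\<forall>n\<in>N. u n \<in> usl2_homogeneous (2 * n)" and x: "x = sum u N"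
    unfolding usl2_even_def by blast
  then show "\<exists>p. x = abs_usl2 p \<and> (\<forall>w\<in>Poly_Mapping.keys p. even (sl2_word_degree w))"
    unfolding x
  proof (induction N)
    case empty
    show ?case by (rule exI[of _ 0]) (simp add: zero_usl2_def)
  next
    case (insert n N)
    obtain p where p: "sum u N = abs_usl2 p" "\<forall>w\<in>Poly_Mapping.keys p. even (sl2_word_degree w)"
      using insert by auto
    obtain q where q: "u n = abs_usl2 q" "\<forall>w\<in>Poly_Mapping.keys q. sl2_word_degree w = 2 * n"
      using insert.prems unfolding usl2_homogeneous_def by auto
    show ?case
      using p q insert.hyps Poly_Mapping.keys_add[of q p]
      by (intro exI[of _ "q + p"]) (force simp: plus_usl2.abs_eq)
  qed
next
  assume "\<exists>p. x = abs_usl2 p \<and> (\<forall>w\<in>Poly_Mapping.keys p. even (sl2_word_degree w))"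
  then obtain p where x: "x = abs_usl2 p"
    and even: "\<forall>w\<in>Poly_Mapping.keys p. even (sl2_word_degree w)" by blast
  have single: "abs_usl2 (Poly_Mapping.single w a) \<in> usl2_even" if "even (sl2_word_degree w)" for w a
    using that by (intro usl2_even_homogeneous[of _ "sl2_word_degree w"])
      (auto simp: usl2_homogeneous_def)
  from even show "x \<in> usl2_even"
    unfolding x
    by (rule supported_free_algebra_induct)
      (use usl2_even_zero usl2_even_add single in
        \<open>simp_all add: zero_usl2.abs_eq[symmetric] plus_usl2.abs_eq[symmetric]\<close>)
qed

lemma usl2_even_mult:
  assumes "x \<in> usl2_even" "y \<in> usl2_even"
  shows "x * y \<in> usl2_even"
proof -
  obtain p q where p: "x = abs_usl2 p" "\<forall>w\<in>Poly_Mapping.keys p. even (sl2_word_degree w)"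
    and q: "y = abs_usl2 q" "\<forall>w\<in>Poly_Mapping.keys q. even (sl2_word_degree w)"
    using assms unfolding usl2_even_iff by blast
  have "even (sl2_word_degree w)" if "w \<in> Poly_Mapping.keys (p * q)" for w
    using that keys_mult[of p q] p(2) q(2) by (force simp: sl2_word_degree_def)
  then show ?thesis
    unfolding usl2_even_iff p(1) q(1) times_usl2.abs_eq by blast
qed

lemma usl2_even_word:
  assumes "even (sum_list (map sl2_gen_degree l))"
  shows "a *\<^sub>C prod_list (map sl2_gen_value l) \<in> usl2_even"
  using assms unfolding usl2_even_iff
  by (intro exI[of _ "Poly_Mapping.single (Word l) a"]) (auto simp: abs_usl2_single sl2_word_degree_def)

lemma usl2_even_generators:
  "1 \<in> usl2_even" "sl2_H \<in> usl2_even" "sl2_E ^ 2 \<in> usl2_even" "sl2_F ^ 2 \<in> usl2_even"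
  "sl2_E * sl2_F \<in> usl2_even" "sl2_F * sl2_E \<in> usl2_even"
  using usl2_even_word[of "[]" 1] usl2_even_word[of "[GH]" 1] usl2_even_word[of "[GE, GE]" 1]
    usl2_even_word[of "[GF, GF]" 1] usl2_even_word[of "[GE, GF]" 1] usl2_even_word[of "[GF, GE]" 1]
  by (simp_all add: sl2_gen_value_def power2_eq_square)

lemma usl2_even_scaleC: "x \<in> usl2_even \<Longrightarrow> a *\<^sub>C x \<in> usl2_even"
  using usl2_even_mult[OF usl2_even_word[of "[]" a], of x] by simp

lemma usl2_even_diff: "x \<in> usl2_even \<Longrightarrow> y \<in> usl2_even \<Longrightarrow> x - y \<in> usl2_even"
  using usl2_even_add[of x "(-1) *\<^sub>C y"] usl2_even_scaleC[of y "-1"] by simp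

text \<open>Words of even degree are treated together with words of odd degree by induction on the length:
  the invariant for an odd word \<open>v\<close> is that both \<open>E v\<close> and \<open>F v\<close> lie in the subalgebra. Prefixing
  \<open>E\<close> or \<open>F\<close> to an even word then produces a product of two of these letters, and an inner
  \<open>H\<close> moves to the left up to a scalar multiple.\<close>

lemma usl2_even_subset:
  assumes gens: "1 \<in> R" "sl2_H \<in> R" "sl2_E ^ 2 \<in> R" "sl2_F ^ 2 \<in> R" "sl2_E * sl2_F \<in> R" "sl2_F * sl2_E \<in> R"
    and add: "\<And>x y. x \<in> R \<Longrightarrow> y \<in> R \<Longrightarrow> x + y \<in> R"
    and mult: "\<And>x y. x \<in> R \<Longrightarrow> y \<in> R \<Longrightarrow> x * y \<in> R"
    and scale: "\<And>a x. x \<in> R \<Longrightarrow> a *\<^sub>C x \<in> R"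
  shows "usl2_even \<subseteq> R"
proof
  have EH: "sl2_E * sl2_H = sl2_H * sl2_E + (- 2) *\<^sub>C sl2_E"
    and FH: "sl2_F * sl2_H = sl2_H * sl2_F + 2 *\<^sub>C sl2_F"
    using sl2_commutators(1,2)
    by (simp_all add: commutator_def numeral_mult_scaleC[where 'a = usl2] algebra_simps)
  have word: "(even (sum_list (map sl2_gen_degree l)) \<longrightarrow> prod_list (map sl2_gen_value l) \<in> R) \<and>
    (odd (sum_list (map sl2_gen_degree l)) \<longrightarrow>
      sl2_E * prod_list (map sl2_gen_value l) \<in> R \<and> sl2_F * prod_list (map sl2_gen_value l) \<in> R)" for l
  proof (induction l)
    case (Cons g l)
    define v where "v = prod_list (map sl2_gen_value l)"
    have H: "sl2_E * (sl2_H * v) \<in> R" "sl2_F * (sl2_H * v) \<in> R" if "sl2_E * v \<in> R" "sl2_F * v \<in> R"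
    proof -
      have "sl2_E * (sl2_H * v) = sl2_H * (sl2_E * v) + (- 2) *\<^sub>C (sl2_E * v)"
        "sl2_F * (sl2_H * v) = sl2_H * (sl2_F * v) + 2 *\<^sub>C (sl2_F * v)"
        by (simp_all add: mult.assoc[symmetric] EH FH distrib_right left_diff_distrib)
      then show "sl2_E * (sl2_H * v) \<in> R" "sl2_F * (sl2_H * v) \<in> R"
        using that by (metis add mult scale gens(2))+
    qed
    have pairs: "sl2_E * (sl2_E * v) \<in> R" "sl2_E * (sl2_F * v) \<in> R"
      "sl2_F * (sl2_E * v) \<in> R" "sl2_F * (sl2_F * v) \<in> R" if "v \<in> R"
      using that gens mult by (metis mult.assoc power2_eq_square)+
    show ?case
      using Cons.IH H pairs mult[OF gens(2)]
      by (cases g) (auto simp: sl2_gen_value_def v_def)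
  qed (use gens in simp)
  fix x assume "x \<in> usl2_even"
  then obtain p where x: "x = abs_usl2 p" and "\<forall>w\<in>Poly_Mapping.keys p. even (sl2_word_degree w)"
    unfolding usl2_even_iff by blast
  from this(2) show "x \<in> R"
    unfolding x
  proof (rule supported_free_algebra_induct)
    show "abs_usl2 0 \<in> R"
      using scale[OF gens(1), of 0] by (simp add: zero_usl2.abs_eq[symmetric])
    show "abs_usl2 (Poly_Mapping.single w a) \<in> R" if "even (sl2_word_degree w)" for w a
      using that word[of "letters w"] scale by (simp add: abs_usl2_single sl2_word_degree_def)
  qed (simp add: plus_usl2.abs_eq[symmetric] add)
qed

section \<open>The image\<close>

lemma sl2_swap:
  shows "sl2_H * sl2_E = sl2_E * sl2_H + 2 * sl2_E"
    and "sl2_H * sl2_F = sl2_F * sl2_H - 2 * sl2_F"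
    and "sl2_F * sl2_E = sl2_E * sl2_F - sl2_H"
  using sl2_commutators by (simp_all add: commutator_def algebra_simps)

lemma sl2_swap_nested:
  "sl2_H * (sl2_E * x) = sl2_E * (sl2_H * x) + 2 * (sl2_E * x)"
  "sl2_H * (sl2_F * x) = sl2_F * (sl2_H * x) - 2 * (sl2_F * x)"
  "sl2_F * (sl2_E * x) = sl2_E * (sl2_F * x) - sl2_H * x"
  by (metis sl2_swap distrib_right left_diff_distrib mult.assoc)+

text \<open>With \<open>v = 4 \<natural>(D)\<close> this relation is the image of the equation \<open>16 \<Omega> = 24 \<alpha> - 3\<close>, since
  \<open>16 (S\<^sup>2 - C\<^sup>2)\<close> goes to \<open>(E\<^sup>2 + F\<^sup>2)\<^sup>2 - (E\<^sup>2 - F\<^sup>2)\<^sup>2 = 2 (E\<^sup>2 F\<^sup>2 + F\<^sup>2 E\<^sup>2)\<close>.\<close>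

lemma sl2_fourth_degree_relation:
  defines "v \<equiv> sl2_E * sl2_F + sl2_F * sl2_E - 1"
  shows "2 * (sl2_E ^ 2 * sl2_F ^ 2 + sl2_F ^ 2 * sl2_E ^ 2) = v ^ 2 - 2 * v + 3 * sl2_H ^ 2 - 3"
proof -
  have "(3::usl2) = 1 + 1 + 1" by simp
  then show ?thesis
    unfolding v_def by (simp add: ring_expand sl2_swap sl2_swap_nested del: one_add_one)
qed

locale natural_homomorphism = algebra_homomorphism natural
  for natural :: "hahn \<Rightarrow> usl2" +
  assumes A: "natural hahn_A = (1/4) *\<^sub>C sl2_H"
    and B: "natural hahn_B = (1/4) *\<^sub>C (sl2_E ^ 2 + sl2_F ^ 2 + sl2_casimir - 1) - (1/8) *\<^sub>C sl2_H ^ 2"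
    and C: "natural hahn_C = (1/4) *\<^sub>C (sl2_E ^ 2 - sl2_F ^ 2)"
begin

lemma sym: "natural hahn_sym = (1/4) *\<^sub>C (sl2_E ^ 2 + sl2_F ^ 2)"
proof -
  have "commutator sl2_H (sl2_E ^ 2 - sl2_F ^ 2) = 4 *\<^sub>C (sl2_E ^ 2 + sl2_F ^ 2)"
    unfolding numeral_mult_scaleC[symmetric]
    by (simp add: ring_expand sl2_swap sl2_swap_nested)
  then show ?thesis
    by (simp add: hahn_sym_def commutator A C commutator_scaleC)
qed

lemma diag: "natural hahn_diag = (1/4) *\<^sub>C (sl2_E * sl2_F + sl2_F * sl2_E - 1)"
  unfolding hahn_diag_def diff sym B
  by (simp add: sl2_casimir_def scaleC_add_right scaleC_diff_right)

lemma raise: "natural hahn_raise = (1/2) *\<^sub>C sl2_E ^ 2"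
  and lower: "natural hahn_lower = (1/2) *\<^sub>C sl2_F ^ 2"
proof -
  have half: "(1/4) *\<^sub>C y + (1/4) *\<^sub>C y = (1/2) *\<^sub>C y" for y :: usl2
    by (simp add: scaleC_add_left[symmetric])
  show "natural hahn_raise = (1/2) *\<^sub>C sl2_E ^ 2" "natural hahn_lower = (1/2) *\<^sub>C sl2_F ^ 2"
    by (simp_all add: hahn_raise_def hahn_lower_def add diff sym C half[symmetric]
        scaleC_add_right scaleC_diff_right)
qed

lemma beta: "natural hahn_beta = 0"
proof -
  define S D V where "S = sl2_E ^ 2 + sl2_F ^ 2" and "D = sl2_E ^ 2 - sl2_F ^ 2"
    and "V = sl2_E * sl2_F + sl2_F * sl2_E - 1"
  have "natural hahn_beta = (1/16) *\<^sub>C (commutator S D + 4 * (V * sl2_H))"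
    by (simp add: hahn_beta_eq simps sym C diag A S_def[symmetric] D_def[symmetric] V_def[symmetric]
        commutator_scaleC scaleC_add_right mult.assoc numeral_mult_scaleC[where 'a = usl2])
  moreover have "commutator S D + 4 * (V * sl2_H) = 0"
    by (simp add: S_def D_def V_def ring_expand sl2_swap sl2_swap_nested)
  ultimately show ?thesis by simp
qed

lemma kernel_relator: "natural hahn_kernel_relator = 0"
proof -
  define v where "v = sl2_E * sl2_F + sl2_F * sl2_E - 1"
  define S D where "S = sl2_E ^ 2 + sl2_F ^ 2" and "D = sl2_E ^ 2 - sl2_F ^ 2"
  have "natural hahn_kernel_relator
    = S ^ 2 - D ^ 2 + 8 * v - v ^ 2 - 6 * v - 3 * sl2_H ^ 2 + 3"
    by (simp add: hahn_kernel_relator_def hahn_casimir_eq hahn_alpha_eq simps sym C diag A beta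
        v_def[symmetric] S_def[symmetric] D_def[symmetric]
        scaleC_power2
        numeral_mult_scaleC[where 'a = usl2] scaleC_add_right scaleC_diff_right)
  also have "\<dots> = 2 * (sl2_E ^ 2 * sl2_F ^ 2 + sl2_F ^ 2 * sl2_E ^ 2)
    - (v ^ 2 - 2 * v + 3 * sl2_H ^ 2 - 3)"
  proof -
    have "(8::usl2) = 6 + 2" by simp
    then have "8 * v = 6 * v + 2 * v" by (metis distrib_right)
    moreover have "S ^ 2 - D ^ 2 = 2 * (sl2_E ^ 2 * sl2_F ^ 2 + sl2_F ^ 2 * sl2_E ^ 2)"
    proof -
      have "(X + Y) ^ 2 - (X - Y) ^ 2 = 2 * (X * Y + Y * X)" for X Y :: usl2
        by (simp add: ring_expand)
      then show ?thesis by (simp add: S_def D_def)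
    qed
    ultimately show ?thesis by simp
  qed
  also have "\<dots> = 0"
    using sl2_fourth_degree_relation by (simp add: v_def)
  finally show ?thesis .
qed

lemma kernel_ideal_subset: "hahn_kernel_ideal \<subseteq> {x. natural x = 0}"
  unfolding hahn_kernel_ideal_def
  by (rule ideal_generated_minimal[OF two_sided_ideal_kernel]) (simp add: beta kernel_relator)

lemma range_eq: "range natural = usl2_even"
proof
  show "range natural \<subseteq> usl2_even"
  proof clarify
    fix x
    note even = usl2_even_generators usl2_even_add usl2_even_diff usl2_even_scaleC usl2_even_mult
    show "natural x \<in> usl2_even"
    proof (induction x rule: hahn_induct)
      case B
      have "natural hahn_B = natural hahn_sym + natural hahn_diag"
        by (simp add: hahn_diag_def diff)
      then show ?case by (auto simp: sym diag intro!: even)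
    qed (auto simp: simps A C intro!: even)
  qed
  show "usl2_even \<subseteq> range natural"
  proof (rule usl2_even_subset)
    have scaled: "a *\<^sub>C natural x \<in> range natural" for a x
      by (metis rangeI scale)
    have "natural 1 = 1" "4 *\<^sub>C natural hahn_A = sl2_H" "2 *\<^sub>C natural hahn_raise = sl2_E ^ 2"
      "2 *\<^sub>C natural hahn_lower = sl2_F ^ 2"
      by (simp_all add: one A raise lower)
    then show "1 \<in> range natural" "sl2_H \<in> range natural" "sl2_E ^ 2 \<in> range natural"
      "sl2_F ^ 2 \<in> range natural"
      by (metis rangeI, metis scaled, metis scaled, metis scaled)
    \<comment> \<open>The image of \<open>D\<close> yields \<open>EF + FE\<close>; as \<open>EF - FE = H\<close>, both products are in the image.\<close>
    have P: "natural (2 *\<^sub>C hahn_diag + (1/2) *\<^sub>C 1) = (1/2) *\<^sub>C (sl2_E * sl2_F + sl2_F * sl2_E)"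
      by (simp add: simps diag scaleC_diff_right)
    have half: "(1/2) *\<^sub>C y + (1/2) *\<^sub>C y = y" for y :: usl2
      by (simp add: scaleC_add_left[symmetric])
    have "(1/2) *\<^sub>C (sl2_E * sl2_F + sl2_F * sl2_E) + (1/2) *\<^sub>C sl2_H = sl2_E * sl2_F"
      "(1/2) *\<^sub>C (sl2_E * sl2_F + sl2_F * sl2_E) - (1/2) *\<^sub>C sl2_H = sl2_F * sl2_E"
      unfolding sl2_swap(3) by (simp_all add: scaleC_add_right scaleC_diff_right half algebra_simps)
    moreover have "natural (2 *\<^sub>C hahn_A) = (1/2) *\<^sub>C sl2_H"
      by (simp add: scale A)
    ultimately show "sl2_E * sl2_F \<in> range natural" "sl2_F * sl2_E \<in> range natural"
      using P by (metis rangeI add, metis rangeI diff)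
    fix x y a assume "x \<in> range natural" "y \<in> range natural"
    then show "x + y \<in> range natural" "x * y \<in> range natural" "a *\<^sub>C x \<in> range natural"
      by (auto simp: simps[symmetric])
  qed
qed

end

section \<open>Difference operators\<close>

text \<open>The linear endomorphisms of a space of functions, made into a type so that they form a complex
  algebra and can serve as the target of a homomorphism from \<open>U(sl\<^sub>2)\<close>.\<close>

typedef 'x linear_operator =
  "{T :: ('x \<Rightarrow> complex) \<Rightarrow> 'x \<Rightarrow> complex.
     (\<forall>f g. T (\<lambda>x. f x + g x) = (\<lambda>x. T f x + T g x)) \<and> (\<forall>a f. T (\<lambda>x. a * f x) = (\<lambda>x. a * T f x))}"
  morphisms operate Linear_operator
  by (rule exI[of _ id]) auto

setup_lifting type_definition_linear_operator

instantiation linear_operator :: (type) complex_algebra_1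
begin
lift_definition zero_linear_operator :: "'a linear_operator" is "\<lambda>f x. 0" by simp
lift_definition one_linear_operator :: "'a linear_operator" is "\<lambda>f. f" by simp
lift_definition plus_linear_operator :: "'a linear_operator \<Rightarrow> 'a linear_operator \<Rightarrow> 'a linear_operator"
  is "\<lambda>S T f x. S f x + T f x" by (simp add: algebra_simps)
lift_definition minus_linear_operator :: "'a linear_operator \<Rightarrow> 'a linear_operator \<Rightarrow> 'a linear_operator"
  is "\<lambda>S T f x. S f x - T f x" by (simp add: algebra_simps)
lift_definition uminus_linear_operator :: "'a linear_operator \<Rightarrow> 'a linear_operator"
  is "\<lambda>T f x. - T f x" by simp
lift_definition times_linear_operator :: "'a linear_operator \<Rightarrow> 'a linear_operator \<Rightarrow> 'a linear_operator"
  is "\<lambda>S T f. S (T f)" by simp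
lift_definition scaleC_linear_operator :: "complex \<Rightarrow> 'a linear_operator \<Rightarrow> 'a linear_operator"
  is "\<lambda>a T f x. a * T f x" by (simp add: algebra_simps)

instance
proof
  show "(0::'a linear_operator) \<noteq> 1"
    by transfer (metis zero_neq_one)
qed (transfer; simp add: algebra_simps)+
end

lemma operate_sum: "operate (\<Sum>i\<in>I. T i) f x = (\<Sum>i\<in>I. operate (T i) f x)"
  by (induction I rule: infinite_finite_induct)
    (simp_all add: zero_linear_operator.rep_eq plus_linear_operator.rep_eq)

lemma linear_operator_eqI:
  "(\<And>f x. operate S f x = operate T f x) \<Longrightarrow> S = T"
  by (metis operate_inject ext)

lemmas operate_simps = zero_linear_operator.rep_eq one_linear_operator.rep_eq
  plus_linear_operator.rep_eq minus_linear_operator.rep_eq uminus_linear_operator.rep_eq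
  times_linear_operator.rep_eq scaleC_linear_operator.rep_eq

text \<open>In the representation below, \<open>H\<close> multiplies by \<open>4 t\<close> and the Casimir element \<open>\<Lambda>\<close> by \<open>4 z + 1\<close>;
  these normalisations make \<open>A = H/4\<close> act by \<open>t\<close> and \<open>\<alpha>\<close>, whose image is \<open>(\<Lambda> - 1)/4\<close>, by \<open>z\<close>.
  As \<open>\<Lambda> = 2 EF - H + H\<^sup>2/2\<close>, the product \<open>EF\<close> must multiply by \<open>(2 \<Lambda> - H\<^sup>2 + 2 H)/4\<close>, which is the
  function defined here. Letting \<open>E\<close> be a pure shift of \<open>t\<close> by \<open>1/2\<close> leaves the whole coefficient to
  \<open>F\<close>.\<close>

definition EF_symbol :: "complex \<Rightarrow> complex \<Rightarrow> complex" where
  "EF_symbol z t = 2 * z + 1 / 2 - 4 * t ^ 2 + 2 * t"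

lift_definition op_E :: "(complex \<times> complex) linear_operator" is "\<lambda>f (z, t). f (z, t - 1 / 2)"
  by (auto simp: fun_eq_iff)
lift_definition op_F :: "(complex \<times> complex) linear_operator"
  is "\<lambda>f (z, t). EF_symbol z (t + 1 / 2) * f (z, t + 1 / 2)"
  by (auto simp: fun_eq_iff algebra_simps)
lift_definition op_H :: "(complex \<times> complex) linear_operator" is "\<lambda>f (z, t). 4 * t * f (z, t)"
  by (auto simp: fun_eq_iff algebra_simps)

lemma EF_symbol_diff: "EF_symbol z t - EF_symbol z (t + 1 / 2) = 4 * t"
  by (simp add: EF_symbol_def power2_eq_square distrib_left distrib_right add_divide_distrib)

lemmas op_rep_eq = op_E.rep_eq op_F.rep_eq op_H.rep_eq operate_simps
  numeral_mult_scaleC[where 'a = "'x linear_operator"]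

lemma op_relations:
  shows "commutator op_H op_E = 2 * op_E"
    and "commutator op_H op_F = - 2 * op_F"
    and "commutator op_E op_F = op_H"
proof -
  show "commutator op_H op_E = 2 * op_E"
  proof (rule linear_operator_eqI, clarify)
    fix f :: "complex \<times> complex \<Rightarrow> complex" and z t
    show "operate (commutator op_H op_E) f (z, t) = operate (2 * op_E) f (z, t)"
      by (simp add: commutator_def op_rep_eq right_diff_distrib left_diff_distrib)
  qed
  show "commutator op_H op_F = - 2 * op_F"
  proof (rule linear_operator_eqI, clarify)
    fix f :: "complex \<times> complex \<Rightarrow> complex" and z t
    show "operate (commutator op_H op_F) f (z, t) = operate (- 2 * op_F) f (z, t)"
      by (simp add: commutator_def op_rep_eq distrib_left distrib_right mult.left_commute)
  qed
  show "commutator op_E op_F = op_H"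
  proof (rule linear_operator_eqI, clarify)
    fix f :: "complex \<times> complex \<Rightarrow> complex" and z t
    show "operate (commutator op_E op_F) f (z, t) = operate op_H f (z, t)"
      using EF_symbol_diff[of z t]
      by (simp add: commutator_def op_rep_eq left_diff_distrib[symmetric])
  qed
qed

text \<open>The universal property of \<open>U(sl\<^sub>2)\<close>.\<close>

lemma ex_usl2_hom:
  fixes e f h :: "'a::complex_algebra_1"
  assumes "commutator h e = 2 * e" "commutator h f = - 2 * f" "commutator e f = h"
  shows "\<exists>\<phi>. algebra_hom \<phi> \<and> \<phi> sl2_E = e \<and> \<phi> sl2_F = f \<and> \<phi> sl2_H = h"
proof -
  define v where "v = case_sl2_gen e f h"
  define \<phi> where "\<phi> x = free_lift v (rep_usl2 x)" for x
  have "free_lift v p = 0" if "p \<in> sl2_relations" for p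
    using that assms
    by (auto simp: sl2_relations_def commutator_def free_lift_simps v_def)
  then have abs: "\<phi> (abs_usl2 p) = free_lift v p" for p
    unfolding \<phi>_def
    by (rule free_lift_cong_ideal[OF _ Quotient_rep_abs[OF Quotient_usl2
          equivp_reflp[OF equivp_ideal_cong]]]) simp
  have "\<phi> (x + y) = \<phi> x + \<phi> y" "\<phi> (x * y) = \<phi> x * \<phi> y" "\<phi> (r *\<^sub>C x) = r *\<^sub>C \<phi> x" for x y r
    by (induction x rule: usl2.abs_induct, induction y rule: usl2.abs_induct,
      simp add: plus_usl2.abs_eq times_usl2.abs_eq scaleC_usl2.abs_eq abs free_lift_simps free_lift_const)+
  moreover have "\<phi> 1 = 1" by (simp add: one_usl2_def abs)
  ultimately show ?thesis
    by (intro exI[of _ \<phi>]) (simp add: algebra_hom_def sl2_E_def sl2_F_def sl2_H_def abs v_def)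
qed

section \<open>The kernel\<close>

text \<open>The coefficient with which the \<open>n\<close>-th power of \<open>F\<^sup>2/2\<close> shifts \<open>t\<close> by \<open>n\<close>.\<close>

primrec lowering_coefficient :: "nat \<Rightarrow> complex \<Rightarrow> complex \<Rightarrow> complex" where
  "lowering_coefficient 0 z t = 1"
| "lowering_coefficient (Suc n) z t =
     (1 / 2) * EF_symbol z (t + 1 / 2) * EF_symbol z (t + 1) * lowering_coefficient n z (t + 1)"

definition weight_coefficient :: "int \<Rightarrow> complex \<Rightarrow> complex \<Rightarrow> complex" where
  "weight_coefficient k z t =
     (if 0 \<le> k then (1 / 2) ^ nat k else lowering_coefficient (nat (- k)) z t)"

text \<open>For fixed \<open>t\<close> every \<open>EF_symbol\<close> factor is affine in \<open>z\<close> with leading coefficient \<open>2\<close>.\<close>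

lemma finite_weight_coefficient_zeros: "finite {z. weight_coefficient k z t = 0}"
proof -
  have "{z. EF_symbol z t = 0} \<subseteq> {- (1 / 2 - 4 * t ^ 2 + 2 * t) / 2}" for t
    by (auto simp: EF_symbol_def field_simps add_eq_0_iff)
  then have "finite {z. EF_symbol z t = 0}" for t
    by (rule finite_subset) simp
  then have "finite {z. lowering_coefficient n z t = 0}" for n
    by (induction n arbitrary: t) simp_all
  then show ?thesis
    by (simp add: weight_coefficient_def)
qed

text \<open>Infinitely many zeros in \<open>z\<close> are required for each \<open>t\<close>, rather than vanishing everywhere,
  because the weight coefficients may vanish at finitely many \<open>z\<close>.\<close>

lemma bivariate_polynomial_eq_0:
  fixes a :: "nat \<times> nat \<Rightarrow> complex"
  assumes "finite S"
    and zero: "\<And>t. infinite {z. (\<Sum>(i, j)\<in>S. a (i, j) * z ^ i * t ^ j) = 0}"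
    and "s \<in> S"
  shows "a s = 0"
proof -
  define b where "b i j = (if (i, j) \<in> S then a (i, j) else 0)" for i j
  obtain n where n: "S \<subseteq> {..n} \<times> {..n}"
  proof
    show "S \<subseteq> {..Max (fst ` S \<union> snd ` S)} \<times> {..Max (fst ` S \<union> snd ` S)}"
      using \<open>finite S\<close> by (force intro!: Max_ge)
  qed
  have rows: "(\<Sum>(i, j)\<in>S. a (i, j) * z ^ i * t ^ j) = (\<Sum>i\<le>n. (\<Sum>j\<le>n. b i j * t ^ j) * z ^ i)" for z t
  proof -
    have "(\<Sum>(i, j)\<in>S. a (i, j) * z ^ i * t ^ j) = (\<Sum>(i, j)\<in>{..n} \<times> {..n}. b i j * t ^ j * z ^ i)"
      using n by (intro sum.mono_neutral_cong_left) (auto simp: b_def)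
    then show ?thesis by (simp add: sum.cartesian_product[symmetric] sum_distrib_right)
  qed
  have "(\<Sum>j\<le>n. b i j * t ^ j) = 0" if "i \<le> n" for i t
    using zero[of t] that polyfun_finite_roots[where n = n and c = "\<lambda>i. \<Sum>j\<le>n. b i j * t ^ j"]
    unfolding rows by blast
  then have "b i j = 0" if "i \<le> n" "j \<le> n" for i j
    using that polyfun_eq_0[of "b i" n] by blast
  then show ?thesis
    using \<open>s \<in> S\<close> n by (cases s) (force simp: b_def)
qed

context natural_homomorphism
begin

text \<open>Modulo the ideal an element of the kernel is a combination \<open>m\<close> of normal products, and \<open>m\<close> is
  then in the kernel too. Letting \<open>m\<close> act on indicator functions separates the weights \<open>k\<close>, because
  the monomials of weight \<open>k\<close> shift \<open>t\<close> by exactly \<open>k\<close>.\<close>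

lemma kernel_subset_ideal:
  assumes "natural x = 0" shows "x \<in> hahn_kernel_ideal"
proof -
  obtain \<rho> :: "usl2 \<Rightarrow> (complex \<times> complex) linear_operator" where "algebra_hom \<rho>"
    and gens: "\<rho> sl2_E = op_E" "\<rho> sl2_F = op_F" "\<rho> sl2_H = op_H"
    using ex_usl2_hom[OF op_relations] by blast
  interpret \<rho>: algebra_homomorphism \<rho> by unfold_locales fact
  define \<theta> where "\<theta> y = \<rho> (natural y)" for y
  interpret \<theta>: algebra_homomorphism \<theta>
    by unfold_locales (simp add: algebra_hom_def \<theta>_def simps \<rho>.simps)
  have A': "operate (\<theta> hahn_A) f (z, t) = t * f (z, t)" for f z t
    by (simp add: \<theta>_def A \<rho>.simps gens op_rep_eq)
  have raise': "operate (\<theta> hahn_raise) f (z, t) = (1 / 2) * f (z, t - 1)" for f z t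
    by (simp add: \<theta>_def raise \<rho>.simps gens op_rep_eq power2_eq_square)
  have lower': "operate (\<theta> hahn_lower) f (z, t)
      = (1 / 2) * EF_symbol z (t + 1 / 2) * EF_symbol z (t + 1) * f (z, t + 1)" for f z t
    by (simp add: \<theta>_def lower \<rho>.simps gens op_rep_eq power2_eq_square add.assoc)
  have diag': "operate (\<theta> hahn_diag) f (z, t) = (z - 2 * t ^ 2) * f (z, t)" for f z t
  proof -
    have "operate (\<theta> hahn_diag) f (z, t)
      = (1 / 4) * (EF_symbol z t + EF_symbol z (t + 1 / 2) - 1) * f (z, t)"
      by (simp add: \<theta>_def diag \<rho>.simps gens op_rep_eq algebra_simps)
    also have "(1 / 4) * (EF_symbol z t + EF_symbol z (t + 1 / 2) - 1) = z - 2 * t ^ 2"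
      by (simp add: EF_symbol_def power2_eq_square field_simps)
    finally show ?thesis .
  qed
  have alpha': "operate (\<theta> hahn_alpha) f (z, t) = z * f (z, t)" for f z t
    by (simp add: hahn_alpha_eq \<theta>.simps op_rep_eq diag' A' power2_eq_square algebra_simps)
  have alpha_power: "operate (\<theta> (hahn_alpha ^ i)) f (z, t) = z ^ i * f (z, t)" for i f z t
    by (induction i) (simp_all add: \<theta>.one \<theta>.mult operate_simps alpha')
  have A_power: "operate (\<theta> (hahn_A ^ j)) f (z, t) = t ^ j * f (z, t)" for j f z t
    by (induction j) (simp_all add: \<theta>.one \<theta>.mult operate_simps A')
  have raise_power: "operate (\<theta> (hahn_raise ^ n)) f (z, t) = (1 / 2) ^ n * f (z, t - of_nat n)" for n f z t
    by (induction n arbitrary: t) (simp_all add: \<theta>.one \<theta>.mult operate_simps raise' algebra_simps)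
  have lower_power: "operate (\<theta> (hahn_lower ^ n)) f (z, t)
      = lowering_coefficient n z t * f (z, t + of_nat n)" for n f z t
    by (induction n arbitrary: t) (simp_all add: \<theta>.one \<theta>.mult operate_simps lower' add.assoc)
  have weight: "operate (\<theta> (hahn_weight k)) f (z, t)
      = weight_coefficient k z t * f (z, t - of_int k)" for k f z t
    by (simp add: hahn_weight_def weight_coefficient_def raise_power lower_power)
  have monomial: "operate (\<theta> (hahn_monomial (k, i, j))) f (z, t)
      = weight_coefficient k z t * z ^ i * (t - of_int k) ^ j * f (z, t - of_int k)" for k i j f z t
    by (simp add: hahn_monomial_def \<theta>.mult operate_simps weight alpha_power A_power)

  note ideal = subspace_two_sided_ideal[OF two_sided_ideal_hahn_kernel_ideal]
  have "x \<in> calg.span (hahn_kernel_ideal \<union> range hahn_monomial)"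
    by (rule hahn_normal_span_UNIV)
  then obtain y m where y: "y \<in> hahn_kernel_ideal" and m: "m \<in> calg.span (range hahn_monomial)"
    and x: "x = y + m"
    unfolding calg.span_Un calg.span_eq_iff[THEN iffD2, OF ideal] by blast
  obtain S r where S: "finite S" and m_sum: "m = (\<Sum>s\<in>S. r s *\<^sub>C hahn_monomial s)"
    using calg.span_range_explicit[OF m] by blast
  have "natural m = 0"
    using assms y kernel_ideal_subset by (auto simp: x add)
  then have \<theta>m: "\<theta> m = 0"
    by (simp add: \<theta>_def \<rho>.zero)
  have "r (k, i, j) = 0" if "(k, i, j) \<in> S" for k i j
  proof -
    define T where "T = {(i, j). (k, i, j) \<in> S}"
    have T: "finite T"
      using finite_vimageI[OF S, of "Pair k"] by (simp add: T_def inj_on_def vimage_def case_prod_beta')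
    have slice: "weight_coefficient k z (t + of_int k) * (\<Sum>(i, j)\<in>T. r (k, i, j) * z ^ i * t ^ j) = 0" for z t
    proof -
      \<comment> \<open>Evaluated at \<open>t + k\<close>, the indicator function of \<open>(z, t)\<close> detects only the monomials of
        weight \<open>k\<close>, and the factor \<open>(t + k - k)\<^sup>j\<close> is the plain power of \<open>t\<close>.\<close>
      let ?f = "\<lambda>p. if p = (z, t) then 1 else 0 :: complex"
      let ?g = "\<lambda>s. r s * operate (\<theta> (hahn_monomial s)) ?f (z, t + of_int k)"
      have "0 = operate (\<theta> m) ?f (z, t + of_int k)"
        by (simp add: \<theta>m operate_simps)
      also have "\<dots> = sum ?g S"
        by (simp add: m_sum \<theta>.sum \<theta>.scale operate_sum operate_simps)
      also have "\<dots> = sum ?g (Pair k ` T)"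
        using S by (intro sum.mono_neutral_right) (auto simp: T_def monomial split: if_splits)
      also have "\<dots> = (\<Sum>p\<in>T. ?g (k, p))"
        by (simp add: sum.reindex inj_on_def)
      also have "\<dots> = weight_coefficient k z (t + of_int k) * (\<Sum>(i, j)\<in>T. r (k, i, j) * z ^ i * t ^ j)"
        by (simp add: sum_distrib_left case_prod_beta' monomial[of k "fst p" "snd p" for p, simplified] mult_ac)
      finally show ?thesis by simp
    qed
    have "infinite {z. (\<Sum>(i, j)\<in>T. r (k, i, j) * z ^ i * t ^ j) = 0}" for t
    proof
      assume "finite {z. (\<Sum>(i, j)\<in>T. r (k, i, j) * z ^ i * t ^ j) = 0}"
      with finite_weight_coefficient_zeros
      have "finite ({z. weight_coefficient k z (t + of_int k) = 0}
          \<union> {z. (\<Sum>(i, j)\<in>T. r (k, i, j) * z ^ i * t ^ j) = 0})"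
        by (rule finite_UnI)
      moreover have "{z. weight_coefficient k z (t + of_int k) = 0}
          \<union> {z. (\<Sum>(i, j)\<in>T. r (k, i, j) * z ^ i * t ^ j) = 0} = UNIV"
        using slice by auto
      ultimately have "finite (UNIV :: complex set)" by metis
      then show False by (simp add: infinite_UNIV_char_0)
    qed
    then show ?thesis
      using bivariate_polynomial_eq_0[OF T, of "\<lambda>p. r (k, p)" "(i, j)"] that by (simp add: T_def)
  qed
  then have "m = 0"
    unfolding m_sum by (intro sum.neutral) auto
  then show ?thesis using x y by simp
qed

end

theorem theorem1p5:
  fixes natural :: "hahn \<Rightarrow> usl2"
  assumes "algebra_hom natural"
    and "natural hahn_A = (1/4) *\<^sub>C sl2_H"
    and "natural hahn_B = (1/4) *\<^sub>C (sl2_E ^ 2 + sl2_F ^ 2 + sl2_casimir - 1) - (1/8) *\<^sub>C sl2_H ^ 2"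
    and "natural hahn_C = (1/4) *\<^sub>C (sl2_E ^ 2 - sl2_F ^ 2)"
  shows "range natural = usl2_even \<and>
    {x. natural x = 0} = ideal_generated {hahn_beta, 16 * hahn_casimir - 24 * hahn_alpha + 3}"
proof -
  interpret natural_homomorphism natural
    by unfold_locales (fact assms)+
  show ?thesis
    using range_eq kernel_ideal_subset kernel_subset_ideal
    by (auto simp: hahn_kernel_ideal_def hahn_kernel_relator_def)
qed

end
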